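(* Let $\alpha$ not be a rational multiple of $\pi$. If there is an $N$-tiling of some isosceles triangle $ABC$ with base angles $\alpha$ by a tile with angles $(\alpha,\beta,2\pi/3)$, then $N$ is at least $33$. If moreover $N\le 200$, and the tile is scaled to have integer sides $(a,b,c)$ with no common factor, then $N$, the tile $(a,b,c)$, and the length $X$ of the two equal sides $AB,BC$ and the length $Y$ of the base $AC$ must be as in one of the following rows, written $N:\ (a,b,c),\ (X,Y)$: $33:\ (5,3,7),\ (21,33)$; $37:\ (5,16,19),\ (76,148)$; $46:\ (7,8,13),\ (52,92)$; $65:\ (3,5,7),\ (35,65)$; $71:\ (39,16,49),\ (196,284)$; $74:\ (56,9,61),\ (183,222)$; $130:\ (16,5,19),\ (95,130)$; $132:\ (5,3,7),\ (42,66)$; $148:\ (5,16,19),\ (152,296)$; $154:\ (8,7,13),\ (91,154)$; $184:\ (7,8,13),\ (104,184)$; $193:\ (143,25,157),\ (785,965)$.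
   Context: An $N$-tiling of a triangle $ABC$ by a triangle $T$ (the tile) is a set of $N$ triangles congruent to $T$ (reflections allowed) whose interiors are pairwise disjoint and whose union is $ABC$ (tiles need not meet edge to edge). The sides $a,b,c$ of the tile are opposite its angles $\alpha,\beta,2\pi/3$ respectively. "Isosceles" means exactly two sides are equal. A tile as in the statement always has rational side ratios, so the scaling to coprime integer sides is possible (with $ABC$ scaled by the same factor). *)

theory Defs
  imports "HOL-Analysis.Analysis"
begin

definition angle_at :: "real^2 \<Rightarrow> real^2 \<Rightarrow> real^2 \<Rightarrow> real" where
  "angle_at V U W = arccos (((U - V) \<bullet> (W - V)) / (norm (U - V) * norm (W - V)))"

definition triangle_region :: "real^2 \<Rightarrow> real^2 \<Rightarrow> real^2 \<Rightarrow> (real^2) set" where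
  "triangle_region A B C = convex hull {A, B, C}"

text \<open>A distance-preserving self-map of the Euclidean plane is automatically bijective, and it may
  reverse orientation, so reflected copies count as congruent.\<close>

definition congruent_sets :: "(real^2) set \<Rightarrow> (real^2) set \<Rightarrow> bool" where
  "congruent_sets S T \<longleftrightarrow> (\<exists>f. (\<forall>x y. dist (f x) (f y) = dist x y) \<and> f ` S = T)"

text \<open>Finiteness is explicit because \<^const>\<open>card\<close> is 0 on infinite sets.\<close>

definition is_tiling :: "nat \<Rightarrow> (real^2) set set \<Rightarrow> (real^2) set \<Rightarrow> (real^2) set \<Rightarrow> bool" where
  "is_tiling N \<T> S T \<longleftrightarrow>
     finite \<T> \<and> card \<T> = N \<and>
     (\<forall>U\<in>\<T>. congruent_sets T U) \<and>
     (\<forall>U\<in>\<T>. \<forall>V\<in>\<T>. U \<noteq> V \<longrightarrow> interior U \<inter> interior V = {}) \<and>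
     \<Union>\<T> = S"

text \<open>Here \<open>A B C\<close> has base \<open>A C\<close> and apex \<open>B\<close>; exactly two sides are equal.\<close>

definition isosceles_triangle :: "real^2 \<Rightarrow> real^2 \<Rightarrow> real^2 \<Rightarrow> bool" where
  "isosceles_triangle A B C \<longleftrightarrow>
     \<not> collinear {A, B, C} \<and> dist A B = dist B C \<and> dist A C \<noteq> dist A B"

text \<open>Scaling by the factor \<open>s\<close> gives the triangle \<open>P Q R\<close> integer sides \<open>a, b, c\<close>, opposite
  \<open>P, Q, R\<close> respectively, with no common factor.\<close>

definition coprime_integer_scaling ::
  "real^2 \<Rightarrow> real^2 \<Rightarrow> real^2 \<Rightarrow> real \<Rightarrow> nat \<Rightarrow> nat \<Rightarrow> nat \<Rightarrow> bool" where
  "coprime_integer_scaling P Q R s a b c \<longleftrightarrow>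
     s > 0 \<and> Gcd {a, b, c} = 1 \<and>
     s * dist Q R = real a \<and> s * dist P R = real b \<and> s * dist P Q = real c"

text \<open>Entries are \<open>(N, (a, b, c), (X, Y))\<close>, with \<open>X\<close> the two equal sides and \<open>Y\<close> the base.\<close>

definition tiling_table :: "(nat \<times> (nat \<times> nat \<times> nat) \<times> (real \<times> real)) set" where
  "tiling_table = {
     (33, (5, 3, 7), (21, 33)),
     (37, (5, 16, 19), (76, 148)),
     (46, (7, 8, 13), (52, 92)),
     (65, (3, 5, 7), (35, 65)),
     (71, (39, 16, 49), (196, 284)),
     (74, (56, 9, 61), (183, 222)),
     (130, (16, 5, 19), (95, 130)),
     (132, (5, 3, 7), (42, 66)),
     (148, (5, 16, 19), (152, 296)),
     (154, (8, 7, 13), (91, 154)),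
     (184, (7, 8, 13), (104, 184)),
     (193, (143, 25, 157), (785, 965))}"

end

theory Submission
  imports Defs
begin

text \<open>Let the tile have sides $a, b, c$ opposite the angles $\alpha, \beta, 2\pi/3$, and let the big
  triangle have legs $X$ and base $Y$. The law of cosines gives $c^2 = a^2 + ab + b^2$ and
  $\cos\alpha = (2b+a)/(2c)$, hence $Yc = X(2b+a)$, and comparing areas gives $Nbc = XY$. The heart of
  the matter is that these relations, together with the existence of the tiling, force the tile to
  have rational side ratios. Everything else is arithmetic.

  Rationality comes from signed boundary lengths. Let $f$ be an odd function on
  directions, $f(-d) = -f(d)$; run around every triangle counterclockwise and give each edge the weight
  $f(\mbox{direction})\cdot\mbox{length}$. On each line, the tile edges on one side and the tile edges on
  the other side cover the same set, apart from what lies on the boundary of the big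
  triangle, and they are traversed in opposite directions. So the total weight of the tiles equals
  the weight of the big triangle (\<open>edge_balance\<close>).

  Choose $f$ as follows. Let $d_0$ be the direction of the base. As $\alpha/\pi$ is irrational, a direction
  $d_0 e^{i(k\alpha + m\pi/3)}$ determines $k$ and the parity of $m$, so both $(-1)^m$ and $(-1)^{m+k}$ are
  well defined and odd on these directions; put $f = 0$ on all others. Two
  edges of one tile differ by such a rotation, up to sign. Hence a tile has weight $0$ or
  $\pm(c + (a - b))$ for the first $f$, and $0$ or $\pm(c - (a - b))$ for the second, while the big
  triangle has weight $Y - 2X$ and $Y + 2X$, respectively (\<open>signed_boundary_relation\<close>). So there
  are integers $M_1, M_2$ with
  $Y - 2X = M_1 (c + a - b)$ and $Y + 2X = M_2 (c - a + b)$. Since $(c+a-b)(c-a+b) = 3ab$, the product of these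
  equations combines with the area relation to make $b/a$ rational, and the square of the second one is then a linear
  equation for $c/a$ over the rationals (\<open>commensurable_sides\<close>). Taking for $f$ the signed indicator of the
  direction of a leg shows that $X$ is an integer combination of $a, b, c$
  (\<open>leg_integer_combination\<close>).

  Now scale $a, b, c$ to coprime integers. Then $X$ is an integer with $Nbc^2 = X^2(2b+a)$, and $c$ is coprime
  to $2b+a$, so $X = ct$ and $Nb = t^2(2b+a)$. Here $b$ divides $t^2$, and $N \le 200$ leaves only
  $t \le 9$; with $c = a + k$ the law of cosines determines $a$ from $b$ and $k$. The finitely many cases
  give exactly the table (\<open>small_tilings\<close>), whose smallest entry is $33$.\<close>

section \<open>Triangles as intersections of half planes\<close>

definition cross2 :: "real^2 \<Rightarrow> real^2 \<Rightarrow> real" where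
  "cross2 u v = u $ 1 * v $ 2 - u $ 2 * v $ 1"

text \<open>The three cross products, divided by their sum, are the barycentric coordinates of the point.\<close>

lemma mem_ccw_triangle_iff:
  assumes "cross2 (Q - P) (R - P) > 0"
  shows "x \<in> convex hull {P, Q, R} \<longleftrightarrow>
    cross2 (Q - P) (x - P) \<ge> 0 \<and> cross2 (R - Q) (x - Q) \<ge> 0 \<and> cross2 (P - R) (x - R) \<ge> 0"
proof -
  define D where "D = cross2 (Q - P) (R - P)"
  define u where "u = cross2 (R - Q) (x - Q)"
  define v where "v = cross2 (P - R) (x - R)"
  define w where "w = cross2 (Q - P) (x - P)"
  have D: "D > 0" using assms by (simp add: D_def)
  have sum: "u + v + w = D"
    by (simp add: u_def v_def w_def D_def cross2_def algebra_simps)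
  have comb: "D *\<^sub>R x = u *\<^sub>R P + v *\<^sub>R Q + w *\<^sub>R R"
    by (simp add: vec_eq_iff forall_2 u_def v_def w_def D_def cross2_def algebra_simps)
  show ?thesis
  proof
    assume "x \<in> convex hull {P, Q, R}"
    then obtain a b c where abc: "a \<ge> 0" "b \<ge> 0" "c \<ge> 0" "a + b + c = 1"
      and x: "x = a *\<^sub>R P + b *\<^sub>R Q + c *\<^sub>R R"
      unfolding convex_hull_3 by auto
    have a: "a = 1 - b - c" using abc by simp
    have "u = a * D" "v = b * D" "w = c * D"
      unfolding u_def v_def w_def D_def x a cross2_def by (simp_all add: algebra_simps)
    with abc D have "u \<ge> 0" "v \<ge> 0" "w \<ge> 0" by simp_all
    then show "cross2 (Q - P) (x - P) \<ge> 0 \<and> cross2 (R - Q) (x - Q) \<ge> 0 \<and> cross2 (P - R) (x - R) \<ge> 0"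
      by (simp add: u_def v_def w_def)
  next
    assume "cross2 (Q - P) (x - P) \<ge> 0 \<and> cross2 (R - Q) (x - Q) \<ge> 0 \<and> cross2 (P - R) (x - R) \<ge> 0"
    then have nn: "u \<ge> 0" "v \<ge> 0" "w \<ge> 0" by (simp_all add: u_def v_def w_def)
    have "x = (1 / D) *\<^sub>R (D *\<^sub>R x)" using D by simp
    also have "\<dots> = (u / D) *\<^sub>R P + (v / D) *\<^sub>R Q + (w / D) *\<^sub>R R"
      by (simp add: comb scaleR_add_right)
    finally have "x = (u / D) *\<^sub>R P + (v / D) *\<^sub>R Q + (w / D) *\<^sub>R R" .
    moreover have "u / D + v / D + w / D = 1"
      using sum D by (simp add: add_divide_distrib[symmetric])
    ultimately show "x \<in> convex hull {P, Q, R}"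
      unfolding convex_hull_3 using nn D
      by (intro CollectI exI[of _ "u / D"] exI[of _ "v / D"] exI[of _ "w / D"]) auto
  qed
qed

lemma interior_ccw_triangle:
  assumes "cross2 (Q - P) (R - P) > 0"
    and "cross2 (Q - P) (x - P) > 0" "cross2 (R - Q) (x - Q) > 0" "cross2 (P - R) (x - R) > 0"
  shows "x \<in> interior (convex hull {P, Q, R})"
proof -
  let ?S = "{x. cross2 (Q - P) (x - P) > 0} \<inter> {x. cross2 (R - Q) (x - Q) > 0} \<inter> {x. cross2 (P - R) (x - R) > 0}"
  have "open {x. cross2 u (x - v) > 0}" for u v
    unfolding cross2_def by (intro open_Collect_less continuous_intros)
  then have "open ?S" by (intro open_Int)
  moreover have "?S \<subseteq> convex hull {P, Q, R}"
    by (intro subsetI) (simp add: mem_ccw_triangle_iff[OF assms(1)])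
  moreover have "x \<in> ?S" using assms(2-4) by simp
  ultimately show ?thesis using interior_maximal[of ?S "convex hull {P, Q, R}"] by (meson subsetD)
qed

section \<open>How a triangle meets a line\<close>

text \<open>In coordinates where the line under study is the first axis, this is the cross product of $v - u$
  with $(s, e) - u$: it is positive iff the point $(s, e)$ lies to the left of the oriented edge
  $u \to v$.\<close>

definition line_side :: "real \<times> real \<Rightarrow> real \<times> real \<Rightarrow> real \<Rightarrow> real \<Rightarrow> real" where
  "line_side u v s e = (fst v - fst u) * (e - snd u) - (snd v - snd u) * (s - fst u)"

text \<open>Positivity of \<^term>\<open>line_side u v s (\<sigma> * e)\<close> for all sufficiently small positive $e$, read off
  from its value and its slope at the point $(s, 0)$ of the axis. So $\sigma = 1$ looks at the
  points just above the axis, $\sigma = -1$ at those just below it.\<close>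

definition just_left :: "real \<times> real \<Rightarrow> real \<times> real \<Rightarrow> real \<Rightarrow> real \<Rightarrow> bool" where
  "just_left u v s \<sigma> \<longleftrightarrow> line_side u v s 0 > 0 \<or> (line_side u v s 0 = 0 \<and> \<sigma> * (fst v - fst u) > 0)"

definition just_inside :: "real \<times> real \<Rightarrow> real \<times> real \<Rightarrow> real \<times> real \<Rightarrow> real \<Rightarrow> real \<Rightarrow> bool" where
  "just_inside u v w s \<sigma> \<longleftrightarrow> just_left u v s \<sigma> \<and> just_left v w s \<sigma> \<and> just_left w u s \<sigma>"

text \<open>The indicator function of the segment between $p$ and $q$, signed so that its integral is $q - p$.\<close>

definition signed_interval :: "real \<Rightarrow> real \<Rightarrow> real \<Rightarrow> real" where
  "signed_interval p q s = of_bool (p < s \<and> s < q) - of_bool (q < s \<and> s < p)"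

definition axis_edge :: "real \<times> real \<Rightarrow> real \<times> real \<Rightarrow> real \<Rightarrow> real" where
  "axis_edge u v s = (if snd u = 0 \<and> snd v = 0 then signed_interval (fst u) (fst v) s else 0)"

lemma signed_interval_has_integral: "(signed_interval p q has_integral (q - p)) UNIV"
proof -
  have *: "((\<lambda>s. of_bool (a < s \<and> s < b)) has_integral (if a \<le> b then b - a else 0)) UNIV" for a b :: real
  proof (cases "a \<le> b")
    case True
    have "((\<lambda>s. 1) has_integral (b - a)) {a<..<b}"
      using has_integral_const_real[of "1::real" a b] True
      by (simp add: has_integral_Icc_iff_Ioo)
    then have "((\<lambda>s. if s \<in> {a<..<b} then 1 else 0) has_integral (b - a)) (UNIV :: real set)"
      by (subst has_integral_restrict_UNIV)
    then show ?thesis using True by (simp add: of_bool_def)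
  next
    case False
    then have "(\<lambda>s. of_bool (a < s \<and> s < b)) = (\<lambda>s. 0 :: real)" by auto
    with False show ?thesis by simp
  qed
  have "(signed_interval p q has_integral
      (if p \<le> q then q - p else 0) - (if q \<le> p then p - q else 0)) UNIV"
    unfolding signed_interval_def by (intro has_integral_diff *)
  then show ?thesis by (auto split: if_splits)
qed

lemma axis_edge_has_integral:
  "(axis_edge u v has_integral (if snd u = 0 \<and> snd v = 0 then fst v - fst u else 0)) UNIV"
  unfolding axis_edge_def[abs_def] by (auto simp: signed_interval_has_integral)

lemma line_side_zero_set:
  assumes "u \<noteq> v" and "\<not> (snd u = 0 \<and> snd v = 0)"
  shows "finite {s. line_side u v s 0 = 0}"
proof (cases "snd u = snd v")
  case True
  with assms have "fst u \<noteq> fst v" "snd u \<noteq> 0" by (auto simp: prod_eq_iff)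
  with True have "{s. line_side u v s 0 = 0} = {}" by (auto simp: line_side_def)
  then show ?thesis by simp
next
  case False
  have "{s. line_side u v s 0 = 0} \<subseteq> {fst u - (fst v - fst u) * snd u / (snd v - snd u)}"
    using False by (auto simp: line_side_def field_simps)
  then show ?thesis using finite_subset by blast
qed

lemma just_left_off_axis:
  assumes "line_side u v s 0 \<noteq> 0"
  shows "just_left u v s \<sigma> \<longleftrightarrow> line_side u v s 0 > 0"
  using assms by (auto simp: just_left_def)

lemma just_inside_rotate: "just_inside u v w s \<sigma> = just_inside v w u s \<sigma>"
  by (auto simp: just_inside_def)

text \<open>The triangle lies on one side of the axis, above it or below it according to the direction of
  the edge $u \to v$, because the triangle is counterclockwise. The points of that edge, and no others on
  the axis, have the triangle on exactly one side.\<close>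

lemma just_inside_edge_on_axis:
  assumes "line_side u v (fst w) (snd w) > 0" and "snd u = 0" "snd v = 0"
    and "line_side v w s 0 \<noteq> 0" "line_side w u s 0 \<noteq> 0"
  shows "of_bool (just_inside u v w s 1) - of_bool (just_inside u v w s (-1))
     = axis_edge u v s + axis_edge v w s + axis_edge w u s"
proof -
  have D: "(fst v - fst u) * snd w > 0" using assms by (simp add: line_side_def)
  then have w: "snd w \<noteq> 0" by auto
  have l: "just_left u v s \<sigma> \<longleftrightarrow> \<sigma> * (fst v - fst u) > 0" for \<sigma>
    using assms by (simp add: just_left_def line_side_def)
  have e1: "line_side v w s 0 = snd w * (fst v - s)" and e2: "line_side w u s 0 = snd w * (s - fst u)"
    using assms by (simp_all add: line_side_def algebra_simps)
  have "axis_edge v w s = 0" "axis_edge w u s = 0" using w by (simp_all add: axis_edge_def)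
  moreover have "axis_edge u v s = signed_interval (fst u) (fst v) s"
    using assms by (simp add: axis_edge_def)
  moreover have "of_bool (just_inside u v w s 1) - of_bool (just_inside u v w s (-1))
      = signed_interval (fst u) (fst v) s"
  proof (cases "snd w > 0")
    case True
    with D have "fst u < fst v" by (simp add: zero_less_mult_iff)
    with True show ?thesis
      by (auto simp add: just_inside_def l just_left_off_axis[OF assms(4)] just_left_off_axis[OF assms(5)]
          e1 e2 zero_less_mult_iff signed_interval_def)
  next
    case False
    with D w have "fst v < fst u" "snd w < 0" by (simp_all add: zero_less_mult_iff)
    then show ?thesis
      by (auto simp add: just_inside_def l just_left_off_axis[OF assms(4)] just_left_off_axis[OF assms(5)]
          e1 e2 zero_less_mult_iff signed_interval_def conj_commute)
  qed
  ultimately show ?thesis by simp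
qed

text \<open>An edge that is not part of the axis meets it in at most one point or else is parallel to it, so
  away from finitely many points the edge does not distinguish between the upper and the lower side.\<close>

lemma just_inside_jump:
  assumes D: "line_side u v (fst w) (snd w) > 0"
  shows "\<exists>E. finite E \<and> (\<forall>s. s \<notin> E \<longrightarrow>
      of_bool (just_inside u v w s 1) - of_bool (just_inside u v w s (-1))
     = axis_edge u v s + axis_edge v w s + axis_edge w u s)"
proof -
  let ?Z = "\<lambda>u v. {s. line_side u v s 0 = 0 \<and> \<not> (snd u = 0 \<and> snd v = 0)}"
  have ne: "u \<noteq> v" "v \<noteq> w" "w \<noteq> u"
    using D by (auto simp: line_side_def)
  have fin: "finite (?Z u v)" if "u \<noteq> v" for u v
    by (cases "snd u = 0 \<and> snd v = 0") (use line_side_zero_set[OF that] in simp_all)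
  let ?E = "?Z u v \<union> ?Z v w \<union> ?Z w u"
  have "finite ?E" by (intro finite_UnI fin ne)
  moreover have "of_bool (just_inside u v w s 1) - of_bool (just_inside u v w s (-1))
     = axis_edge u v s + axis_edge v w s + axis_edge w u s" if s: "s \<notin> ?E" for s
  proof -
    have D': "line_side v w (fst u) (snd u) > 0" "line_side w u (fst v) (snd v) > 0"
      using D by (simp_all add: line_side_def algebra_simps)
    have nn: "snd u \<noteq> 0 \<or> snd v \<noteq> 0 \<or> snd w \<noteq> 0"
      using D by (auto simp: line_side_def)
    consider "snd u = 0" "snd v = 0" | "snd v = 0" "snd w = 0" | "snd w = 0" "snd u = 0"
      | "\<not> (snd u = 0 \<and> snd v = 0)" "\<not> (snd v = 0 \<and> snd w = 0)" "\<not> (snd w = 0 \<and> snd u = 0)" by blast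
    then show ?thesis
    proof cases
      case 1
      with s nn have "line_side v w s 0 \<noteq> 0" "line_side w u s 0 \<noteq> 0" by blast+
      with 1 show ?thesis using just_inside_edge_on_axis[OF D] by blast
    next
      case 2
      with s nn have "line_side w u s 0 \<noteq> 0" "line_side u v s 0 \<noteq> 0" by blast+
      with 2 show ?thesis
        using just_inside_edge_on_axis[OF D'(1), of s]
        by (simp add: just_inside_rotate[of u v w] del: of_bool_eq_iff)
    next
      case 3
      with s nn have "line_side u v s 0 \<noteq> 0" "line_side v w s 0 \<noteq> 0" by blast+
      with 3 show ?thesis
        using just_inside_edge_on_axis[OF D'(2), of s]
        by (simp add: just_inside_rotate[of w u v])
    next
      case 4
      with s have nz: "line_side u v s 0 \<noteq> 0" "line_side v w s 0 \<noteq> 0" "line_side w u s 0 \<noteq> 0"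
        by blast+
      have "just_inside u v w s 1 = just_inside u v w s (-1)"
        by (simp add: just_inside_def just_left_off_axis[OF nz(1)] just_left_off_axis[OF nz(2)]
            just_left_off_axis[OF nz(3)])
      moreover have "axis_edge u v s = 0" "axis_edge v w s = 0" "axis_edge w u s = 0"
        using 4 by (auto simp: axis_edge_def)
      ultimately show ?thesis by simp
    qed
  qed
  ultimately show ?thesis by (intro exI[of _ ?E]) simp
qed

section \<open>Balance of edges along one line\<close>

abbreviation ccw :: "real^2 \<Rightarrow> real^2 \<Rightarrow> real^2 \<Rightarrow> bool" where
  "ccw P Q R \<equiv> cross2 (Q - P) (R - P) > 0"

text \<open>The point with coordinates $(s, e)$ in the orthonormal frame at $p$ whose first axis is the line
  through $p$ in the unit direction $m$.\<close>

definition frame_point :: "real^2 \<Rightarrow> real^2 \<Rightarrow> real \<Rightarrow> real \<Rightarrow> real^2" where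
  "frame_point p m s e = p + s *\<^sub>R m + e *\<^sub>R vector [- m $ 2, m $ 1]"

definition frame_coords :: "real^2 \<Rightarrow> real^2 \<Rightarrow> real^2 \<Rightarrow> real \<times> real" where
  "frame_coords p m x = (inner m (x - p), cross2 m (x - p))"

lemma norm_one_sq: "norm (m :: real^2) = 1 \<Longrightarrow> m $ 1 * m $ 1 + m $ 2 * m $ 2 = 1"
  using power2_norm_eq_inner[of m] by (simp add: inner_vec_def sum_2)

lemma inner_2: "inner (u :: real^2) v = u $ 1 * v $ 1 + u $ 2 * v $ 2"
  by (simp add: inner_vec_def sum_2)

lemma line_side_frame:
  assumes "norm m = 1"
  shows "line_side (frame_coords p m U) (frame_coords p m V) s e
    = cross2 (V - U) (frame_point p m s e - U)"
proof -
  have "line_side (frame_coords p m U) (frame_coords p m V) s e - cross2 (V - U) (frame_point p m s e - U)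
    = (m $ 1 * m $ 1 + m $ 2 * m $ 2 - 1) * ((V - U) $ 1 * (p - U) $ 2 - (V - U) $ 2 * (p - U) $ 1)"
    by (simp add: line_side_def frame_coords_def frame_point_def cross2_def inner_2 algebra_simps)
  then show ?thesis using norm_one_sq[OF assms] by simp
qed

lemma line_side_frame_vertex:
  assumes "norm m = 1"
  shows "line_side (frame_coords p m U) (frame_coords p m V) (fst (frame_coords p m W)) (snd (frame_coords p m W))
    = cross2 (V - U) (W - U)"
proof -
  have "line_side (frame_coords p m U) (frame_coords p m V) (fst (frame_coords p m W)) (snd (frame_coords p m W))
    = (m $ 1 * m $ 1 + m $ 2 * m $ 2) * cross2 (V - U) (W - U)"
    by (simp add: line_side_def frame_coords_def cross2_def inner_2 algebra_simps)
  then show ?thesis using norm_one_sq[OF assms] by simp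
qed

text \<open>The side is an affine function of the height $e$. It vanishes identically only if the edge is
  perpendicular to the axis and stands over the point $s$, which the first assumption excludes.\<close>

lemma eventually_line_side:
  assumes "s \<noteq> fst u" "u \<noteq> v" "\<sigma> = 1 \<or> \<sigma> = -1"
  shows "\<forall>\<^sub>F e in at_right 0. line_side u v s (\<sigma> * e) \<noteq> 0 \<and> (line_side u v s (\<sigma> * e) > 0 \<longleftrightarrow> just_left u v s \<sigma>)"
proof (cases "line_side u v s 0 = 0")
  case True
  have "fst v \<noteq> fst u"
  proof
    assume "fst v = fst u"
    with True assms(1) have "snd u = snd v" by (simp add: line_side_def)
    with \<open>fst v = fst u\<close> assms(2) show False by (simp add: prod_eq_iff)
  qed
  moreover have "line_side u v s (\<sigma> * e) = (\<sigma> * (fst v - fst u)) * e" for e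
    using True by (simp add: line_side_def algebra_simps)
  moreover have "\<forall>\<^sub>F e :: real in at_right 0. e > 0"
    by (simp add: eventually_at_right_less)
  ultimately show ?thesis using assms(3) True
    by (elim eventually_mono) (auto simp: just_left_def zero_less_mult_iff)
next
  case False
  have "((\<lambda>e. line_side u v s (\<sigma> * e)) \<longlongrightarrow> line_side u v s (\<sigma> * 0)) (at_right 0)"
    unfolding line_side_def by (intro tendsto_intros)
  then have lim: "((\<lambda>e. line_side u v s (\<sigma> * e)) \<longlongrightarrow> line_side u v s 0) (at_right 0)" by simp
  show ?thesis
  proof (cases "line_side u v s 0 > 0")
    case True
    from order_tendstoD(1)[OF lim True] show ?thesis
      by (elim eventually_mono) (use True in \<open>auto simp: just_left_def\<close>)
  next
    case neg: False
    with False have "line_side u v s 0 < 0" by simp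
    from order_tendstoD(2)[OF lim this] show ?thesis
      by (elim eventually_mono) (use False neg in \<open>auto simp: just_left_def\<close>)
  qed
qed

text \<open>Just off the axis the test point lies on none of the three edge lines, so it lies in the interior
  of the triangle as soon as it lies in the triangle.\<close>

lemma eventually_in_triangle:
  assumes m: "norm m = 1" and t: "ccw P Q R" and \<sigma>: "\<sigma> = 1 \<or> \<sigma> = -1"
    and s: "s \<noteq> fst (frame_coords p m P)" "s \<noteq> fst (frame_coords p m Q)" "s \<noteq> fst (frame_coords p m R)"
  shows "\<forall>\<^sub>F e in at_right 0.
    (frame_point p m s (\<sigma> * e) \<in> convex hull {P, Q, R} \<longleftrightarrow>
       just_inside (frame_coords p m P) (frame_coords p m Q) (frame_coords p m R) s \<sigma>) \<and>
    (frame_point p m s (\<sigma> * e) \<in> convex hull {P, Q, R} \<longrightarrow>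
       frame_point p m s (\<sigma> * e) \<in> interior (convex hull {P, Q, R}))"
proof -
  let ?c = "frame_coords p m"
  have "cross2 (Q - P) (R - P) \<noteq> 0" using t by simp
  then have "line_side (?c P) (?c Q) (fst (?c R)) (snd (?c R)) \<noteq> 0"
    by (simp add: line_side_frame_vertex[OF m])
  then have ne: "?c P \<noteq> ?c Q" "?c Q \<noteq> ?c R" "?c R \<noteq> ?c P"
    by (auto simp: line_side_def)
  note ev = eventually_line_side[OF s(1) ne(1) \<sigma>] eventually_line_side[OF s(2) ne(2) \<sigma>]
     eventually_line_side[OF s(3) ne(3) \<sigma>]
  from eventually_conj[OF ev(1) eventually_conj[OF ev(2,3)]] show ?thesis
  proof (rule eventually_mono)
    fix e
    assume e: "(line_side (?c P) (?c Q) s (\<sigma> * e) \<noteq> 0 \<and>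
           (0 < line_side (?c P) (?c Q) s (\<sigma> * e)) = just_left (?c P) (?c Q) s \<sigma>) \<and>
          (line_side (?c Q) (?c R) s (\<sigma> * e) \<noteq> 0 \<and>
           (0 < line_side (?c Q) (?c R) s (\<sigma> * e)) = just_left (?c Q) (?c R) s \<sigma>) \<and>
          line_side (?c R) (?c P) s (\<sigma> * e) \<noteq> 0 \<and>
          (0 < line_side (?c R) (?c P) s (\<sigma> * e)) = just_left (?c R) (?c P) s \<sigma>"
    let ?y = "frame_point p m s (\<sigma> * e)"
    have "?y \<in> convex hull {P, Q, R} \<longleftrightarrow>
        cross2 (Q - P) (?y - P) > 0 \<and> cross2 (R - Q) (?y - Q) > 0 \<and> cross2 (P - R) (?y - R) > 0"
      using e unfolding mem_ccw_triangle_iff[OF t] line_side_frame[OF m] by linarith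
    moreover have "just_inside (?c P) (?c Q) (?c R) s \<sigma> \<longleftrightarrow>
        cross2 (Q - P) (?y - P) > 0 \<and> cross2 (R - Q) (?y - Q) > 0 \<and> cross2 (P - R) (?y - R) > 0"
      using e unfolding just_inside_def line_side_frame[OF m] by blast
    ultimately show "(?y \<in> convex hull {P, Q, R} \<longleftrightarrow> just_inside (?c P) (?c Q) (?c R) s \<sigma>) \<and>
       (?y \<in> convex hull {P, Q, R} \<longrightarrow> ?y \<in> interior (convex hull {P, Q, R}))"
      using interior_ccw_triangle[OF t] by blast
  qed
qed

text \<open>The contribution of the oriented edge from $U$ to $V$ to the line through $p$ in direction $m$:
  its length, negative if the edge runs against $m$, and $0$ if the edge is not part of the line.\<close>

definition signed_edge_on_line :: "real^2 \<Rightarrow> real^2 \<Rightarrow> real^2 \<Rightarrow> real^2 \<Rightarrow> real" where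
  "signed_edge_on_line p m U V =
     (if cross2 m (U - p) = 0 \<and> cross2 m (V - p) = 0 then inner m (V - U) else 0)"

definition signed_boundary_on_line :: "real^2 \<Rightarrow> real^2 \<Rightarrow> real^2 \<Rightarrow> real^2 \<Rightarrow> real^2 \<Rightarrow> real" where
  "signed_boundary_on_line p m P Q R =
     signed_edge_on_line p m P Q + signed_edge_on_line p m Q R + signed_edge_on_line p m R P"

lemma triangle_boundary_integral:
  fixes p m :: "real^2"
  assumes m: "norm m = 1" and t: "ccw P Q R"
  defines "c \<equiv> frame_coords p m"
  shows "\<exists>E f. finite E \<and> (f has_integral signed_boundary_on_line p m P Q R) UNIV \<and>
     (\<forall>s. s \<notin> E \<longrightarrow> f s = of_bool (just_inside (c P) (c Q) (c R) s 1) - of_bool (just_inside (c P) (c Q) (c R) s (-1)))"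
proof -
  have "line_side (c P) (c Q) (fst (c R)) (snd (c R)) > 0"
    using t by (simp add: c_def line_side_frame_vertex[OF m])
  from just_inside_jump[OF this] obtain E where E: "finite E"
    "\<And>s. s \<notin> E \<Longrightarrow> of_bool (just_inside (c P) (c Q) (c R) s 1) - of_bool (just_inside (c P) (c Q) (c R) s (-1))
     = axis_edge (c P) (c Q) s + axis_edge (c Q) (c R) s + axis_edge (c R) (c P) s" by blast
  have edge: "(axis_edge (c U) (c V) has_integral signed_edge_on_line p m U V) UNIV" for U V
    using axis_edge_has_integral[of "c U" "c V"]
    by (simp add: signed_edge_on_line_def c_def frame_coords_def inner_diff_right if_distrib cong: if_cong)
  have "((\<lambda>s. axis_edge (c P) (c Q) s + axis_edge (c Q) (c R) s + axis_edge (c R) (c P) s)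
      has_integral signed_boundary_on_line p m P Q R) UNIV"
    unfolding signed_boundary_on_line_def by (intro has_integral_add edge)
  with E show ?thesis by (intro exI[of _ E] exI) (auto simp del: of_bool_eq_iff)
qed

text \<open>A tiling by arbitrary, not necessarily congruent, triangles; all vertices are listed
  counterclockwise.\<close>

locale triangle_tiling =
  fixes I :: "'i set" and p q r :: "'i \<Rightarrow> real^2" and A B C :: "real^2"
  assumes finite_tiles: "finite I"
    and tile_ccw: "i \<in> I \<Longrightarrow> ccw (p i) (q i) (r i)"
    and big_ccw: "ccw A B C"
    and disjoint_interiors: "i \<in> I \<Longrightarrow> j \<in> I \<Longrightarrow> i \<noteq> j \<Longrightarrow>
       interior (convex hull {p i, q i, r i}) \<inter> interior (convex hull {p j, q j, r j}) = {}"
    and covers: "(\<Union>i\<in>I. convex hull {p i, q i, r i}) = convex hull {A, B, C}"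
begin

text \<open>A generic point of the line, pushed slightly to one side of it, lies in the big triangle iff it lies in
  some tile, and then in the interior of that tile, hence in no second one.\<close>

lemma just_inside_count:
  fixes x m :: "real^2"
  assumes m: "norm m = 1" and \<sigma>: "\<sigma> = 1 \<or> \<sigma> = -1"
  defines "c \<equiv> frame_coords x m"
  assumes s: "s \<notin> fst ` c ` ({A, B, C} \<union> p ` I \<union> q ` I \<union> r ` I)"
  shows "(\<Sum>i\<in>I. of_bool (just_inside (c (p i)) (c (q i)) (c (r i)) s \<sigma>) :: real)
     = of_bool (just_inside (c A) (c B) (c C) s \<sigma>)"
proof -
  let ?T = "\<lambda>i. convex hull {p i, q i, r i}" and ?S = "convex hull {A, B, C}"
  let ?y = "\<lambda>e. frame_point x m s (\<sigma> * e)"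
  have s': "s \<noteq> fst (c A)" "s \<noteq> fst (c B)" "s \<noteq> fst (c C)"
    "\<And>i. i \<in> I \<Longrightarrow> s \<noteq> fst (c (p i)) \<and> s \<noteq> fst (c (q i)) \<and> s \<noteq> fst (c (r i))"
    using s by blast+
  have big: "\<forall>\<^sub>F e in at_right 0. (?y e \<in> ?S \<longleftrightarrow> just_inside (c A) (c B) (c C) s \<sigma>) \<and>
     (?y e \<in> ?S \<longrightarrow> ?y e \<in> interior ?S)"
    using eventually_in_triangle[OF m big_ccw \<sigma>, of s x] s'(1-3) unfolding c_def by blast
  have "\<forall>\<^sub>F e in at_right 0. \<forall>i\<in>I. (?y e \<in> ?T i \<longleftrightarrow> just_inside (c (p i)) (c (q i)) (c (r i)) s \<sigma>) \<and>
     (?y e \<in> ?T i \<longrightarrow> ?y e \<in> interior (?T i))"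
    using eventually_in_triangle[OF m tile_ccw \<sigma>, of _ s x] s'(4) unfolding c_def
    by (intro eventually_ball_finite[OF finite_tiles]) blast
  from eventually_conj[OF big this] have "\<exists>e. ((?y e \<in> ?S \<longleftrightarrow> just_inside (c A) (c B) (c C) s \<sigma>) \<and>
     (?y e \<in> ?S \<longrightarrow> ?y e \<in> interior ?S)) \<and> (\<forall>i\<in>I. (?y e \<in> ?T i \<longleftrightarrow> just_inside (c (p i)) (c (q i)) (c (r i)) s \<sigma>) \<and>
     (?y e \<in> ?T i \<longrightarrow> ?y e \<in> interior (?T i)))"
    by (rule eventually_happens'[rotated]) simp
  then obtain e where e: "?y e \<in> ?S \<longleftrightarrow> just_inside (c A) (c B) (c C) s \<sigma>"
    "\<And>i. i \<in> I \<Longrightarrow> ?y e \<in> ?T i \<longleftrightarrow> just_inside (c (p i)) (c (q i)) (c (r i)) s \<sigma>"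
    "\<And>i. i \<in> I \<Longrightarrow> ?y e \<in> ?T i \<Longrightarrow> ?y e \<in> interior (?T i)" by blast
  have "(\<Sum>i\<in>I. of_bool (just_inside (c (p i)) (c (q i)) (c (r i)) s \<sigma>) :: real) = (\<Sum>i\<in>I. of_bool (?y e \<in> ?T i))"
    using e(2) by (intro sum.cong) auto
  also have "\<dots> = of_bool (?y e \<in> ?S)"
  proof (cases "?y e \<in> ?S")
    case True
    then obtain i where i: "i \<in> I" "?y e \<in> ?T i" using covers by blast
    have "?y e \<notin> ?T j" if "j \<in> I" "j \<noteq> i" for j
      using disjoint_interiors[OF i(1) that(1)] e(3)[OF i] e(3)[OF that(1)] that(2) by blast
    then have "(\<Sum>j\<in>I. of_bool (?y e \<in> ?T j) :: real) = (\<Sum>j\<in>I. if i = j then 1 else 0)"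
      using i by (intro sum.cong) auto
    then show ?thesis using True i(1) finite_tiles by simp
  next
    case False
    then have "?y e \<notin> ?T i" if "i \<in> I" for i using covers that by blast
    with False show ?thesis by simp
  qed
  finally show ?thesis using e(1) by simp
qed

text \<open>Subtracting the counts on the two sides of the line gives an identity between functions on the
  line, valid off a finite set. Integrating it turns each edge on the line into its signed length.\<close>

lemma line_balance:
  assumes m: "norm m = 1"
  shows "(\<Sum>i\<in>I. signed_boundary_on_line x m (p i) (q i) (r i)) = signed_boundary_on_line x m A B C"
proof -
  define c where "c = frame_coords x m"
  define g where "g P Q R s = (of_bool (just_inside (c P) (c Q) (c R) s 1)
      - of_bool (just_inside (c P) (c Q) (c R) s (-1)) :: real)" for P Q R s
  have "\<forall>i\<in>I. \<exists>E f. finite E \<and> (f has_integral signed_boundary_on_line x m (p i) (q i) (r i)) UNIV \<and>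
     (\<forall>s. s \<notin> E \<longrightarrow> f s = g (p i) (q i) (r i) s)"
    using triangle_boundary_integral[OF m tile_ccw] unfolding g_def c_def by blast
  then obtain E f where Ef: "\<And>i. i \<in> I \<Longrightarrow> finite (E i)"
    "\<And>i. i \<in> I \<Longrightarrow> (f i has_integral signed_boundary_on_line x m (p i) (q i) (r i)) UNIV"
    "\<And>i s. i \<in> I \<Longrightarrow> s \<notin> E i \<Longrightarrow> f i s = g (p i) (q i) (r i) s" by metis
  obtain E0 f0 where Ef0: "finite E0" "(f0 has_integral signed_boundary_on_line x m A B C) UNIV"
    "\<And>s. s \<notin> E0 \<Longrightarrow> f0 s = g A B C s"
    using triangle_boundary_integral[OF m big_ccw] unfolding g_def c_def by blast
  let ?V = "fst ` c ` ({A, B, C} \<union> p ` I \<union> q ` I \<union> r ` I)"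
  have fin: "finite (?V \<union> E0 \<union> (\<Union>i\<in>I. E i))" using finite_tiles Ef(1) Ef0(1) by simp
  have eq: "f0 s = (\<Sum>i\<in>I. f i s)" if "s \<in> UNIV - (?V \<union> E0 \<union> (\<Union>i\<in>I. E i))" for s
  proof -
    from that have s: "s \<notin> ?V" "s \<notin> E0" "\<And>i. i \<in> I \<Longrightarrow> s \<notin> E i" by blast+
    have "(\<Sum>i\<in>I. f i s) = (\<Sum>i\<in>I. g (p i) (q i) (r i) s)" using Ef(3) s(3) by (intro sum.cong) auto
    also have "\<dots> = g A B C s"
      unfolding g_def sum_subtractf
      using just_inside_count[OF m, of 1 s x] just_inside_count[OF m, of "-1" s x] s(1)
      unfolding c_def by simp
    finally show ?thesis using Ef0(3)[OF s(2)] by simp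
  qed
  have "((\<lambda>s. \<Sum>i\<in>I. f i s) has_integral (\<Sum>i\<in>I. signed_boundary_on_line x m (p i) (q i) (r i))) UNIV"
    by (intro has_integral_sum finite_tiles Ef(2))
  from has_integral_spike_finite[OF fin eq this]
  have "(f0 has_integral (\<Sum>i\<in>I. signed_boundary_on_line x m (p i) (q i) (r i))) UNIV" .
  with Ef0(2) show ?thesis using has_integral_unique by blast
qed

end

section \<open>Balance of edges weighted by an odd function of their direction\<close>

definition to_complex :: "real^2 \<Rightarrow> complex" where
  "to_complex v = Complex (v $ 1) (v $ 2)"

definition edge_dir :: "real^2 \<Rightarrow> real^2 \<Rightarrow> complex" where
  "edge_dir U V = to_complex (V - U) / complex_of_real (dist U V)"

definition edge_weight :: "(complex \<Rightarrow> real) \<Rightarrow> real^2 \<Rightarrow> real^2 \<Rightarrow> real" where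
  "edge_weight f U V = f (edge_dir U V) * dist U V"

definition boundary_weight :: "(complex \<Rightarrow> real) \<Rightarrow> real^2 \<Rightarrow> real^2 \<Rightarrow> real^2 \<Rightarrow> real" where
  "boundary_weight f P Q R = edge_weight f P Q + edge_weight f Q R + edge_weight f R P"

definition line_through :: "real^2 \<Rightarrow> real^2 \<Rightarrow> (real^2) set" where
  "line_through U V = {y. cross2 (V - U) (y - U) = 0}"

lemma cross2_scaleR_left: "cross2 (k *\<^sub>R u) w = k * cross2 u w"
  by (simp add: cross2_def algebra_simps)

lemma line_unit_direction:
  assumes "U \<noteq> V"
  shows "\<exists>x m. norm m = 1 \<and> line_through U V = {y. cross2 m (y - x) = 0}"
proof (intro exI conjI)
  let ?m = "(1 / norm (V - U)) *\<^sub>R (V - U)"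
  show "norm ?m = 1" using assms by simp
  show "line_through U V = {y. cross2 ?m (y - U) = 0}"
    using assms by (simp add: line_through_def cross2_scaleR_left)
qed

lemma parallel_to_unit:
  assumes m: "norm m = 1" and "cross2 m w = 0"
  shows "w = inner m w *\<^sub>R m"
proof -
  have 1: "m $ 1 * m $ 1 = 1 - m $ 2 * m $ 2" using norm_one_sq[OF m] by simp
  have c: "m $ 1 * w $ 2 = m $ 2 * w $ 1" using assms(2) by (simp add: cross2_def)
  have "(m $ 1 * w $ 1 + m $ 2 * w $ 2) * m $ 1 = (m $ 1 * m $ 1) * w $ 1 + m $ 2 * (m $ 1 * w $ 2)"
    by (simp add: algebra_simps)
  also have "\<dots> = w $ 1" unfolding c 1 by (simp add: algebra_simps)
  finally have w1: "w $ 1 = (m $ 1 * w $ 1 + m $ 2 * w $ 2) * m $ 1" by simp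
  have "(m $ 1 * w $ 1 + m $ 2 * w $ 2) * m $ 2 = m $ 1 * (m $ 2 * w $ 1) + (m $ 2 * m $ 2) * w $ 2"
    by (simp add: algebra_simps)
  also have "\<dots> = (m $ 1 * m $ 1 + m $ 2 * m $ 2) * w $ 2"
    unfolding c[symmetric] by (simp add: algebra_simps)
  finally have "w $ 2 = (m $ 1 * w $ 1 + m $ 2 * w $ 2) * m $ 2" using norm_one_sq[OF m] by simp
  with w1 show ?thesis by (simp add: vec_eq_iff forall_2 inner_2)
qed

text \<open>Oddness is what makes the weight of an edge a multiple of its signed length: whichever way the
  edge runs, the sign of \<^term>\<open>f\<close> at its direction and the sign of the length agree.\<close>

lemma edge_weight_on_line:
  assumes odd: "\<And>d. f (- d) = - f d" and m: "norm m = 1" and UV: "U \<noteq> V"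
  shows "f (to_complex m) * signed_edge_on_line x m U V
     = (if line_through U V = {y. cross2 m (y - x) = 0} then edge_weight f U V else 0)"
proof (cases "cross2 m (U - x) = 0 \<and> cross2 m (V - x) = 0")
  case True
  define k where "k = inner m (V - U)"
  have "cross2 m (V - U) = 0" using True by (simp add: cross2_def algebra_simps)
  from parallel_to_unit[OF m this] have VU: "V - U = k *\<^sub>R m" by (simp add: k_def)
  have k: "k \<noteq> 0" using VU UV by auto
  have d: "dist U V = \<bar>k\<bar>" using VU m by (metis dist_commute dist_norm mult.right_neutral norm_scaleR)
  have "cross2 (V - U) (y - U) = k * cross2 m (y - x)" for y
    using True unfolding VU by (simp add: cross2_def algebra_simps) algebra
  then have "line_through U V = {y. cross2 m (y - x) = 0}" using k by (simp add: line_through_def)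
  moreover have "edge_dir U V = of_real (k / \<bar>k\<bar>) * to_complex m"
    unfolding edge_dir_def d VU by (simp add: to_complex_def complex_eq_iff)
  then have "edge_weight f U V = f (to_complex m) * k"
    using k odd[of "to_complex m"] by (cases "k > 0") (simp_all add: edge_weight_def d)
  ultimately show ?thesis using True by (simp add: signed_edge_on_line_def k_def)
next
  case False
  have "U \<in> line_through U V" "V \<in> line_through U V" by (simp_all add: line_through_def cross2_def)
  with False have "line_through U V \<noteq> {y. cross2 m (y - x) = 0}" by blast
  moreover have "signed_edge_on_line x m U V = 0" using False by (auto simp: signed_edge_on_line_def)
  ultimately show ?thesis by simp
qed

lemma ccw_distinct: "ccw P Q R \<Longrightarrow> P \<noteq> Q \<and> Q \<noteq> R \<and> R \<noteq> P"
  by (auto simp: cross2_def)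

lemma boundary_weight_by_lines:
  assumes odd: "\<And>d. f (- d) = - f d" and t: "ccw P Q R"
    and L: "finite L" "line_through P Q \<in> L" "line_through Q R \<in> L" "line_through R P \<in> L"
    and m: "\<And>l. l \<in> L \<Longrightarrow> norm (m l) = 1 \<and> l = {y. cross2 (m l) (y - x l) = 0}"
  shows "boundary_weight f P Q R = (\<Sum>l\<in>L. f (to_complex (m l)) * signed_boundary_on_line (x l) (m l) P Q R)"
proof -
  have edge: "(\<Sum>l\<in>L. f (to_complex (m l)) * signed_edge_on_line (x l) (m l) U V) = edge_weight f U V"
    if "U \<noteq> V" "line_through U V \<in> L" for U V
  proof -
    have "(\<Sum>l\<in>L. f (to_complex (m l)) * signed_edge_on_line (x l) (m l) U V)
       = (\<Sum>l\<in>L. if line_through U V = l then edge_weight f U V else 0)"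
      using edge_weight_on_line[of f, OF odd _ that(1)] m by (intro sum.cong refl) metis
    then show ?thesis using that(2) L(1) by simp
  qed
  show ?thesis
    using ccw_distinct[OF t] L edge
    by (simp add: boundary_weight_def signed_boundary_on_line_def distrib_left sum.distrib)
qed

context triangle_tiling
begin

text \<open>The edges are grouped by the lines that contain them; oddness of \<^term>\<open>f\<close> reduces each group to
  \<open>line_balance\<close>.\<close>

theorem edge_balance:
  assumes odd: "\<And>d. f (- d) = - f d"
  shows "(\<Sum>i\<in>I. boundary_weight f (p i) (q i) (r i)) = boundary_weight f A B C"
proof -
  define L where "L = {line_through A B, line_through B C, line_through C A} \<union>
     (\<Union>i\<in>I. {line_through (p i) (q i), line_through (q i) (r i), line_through (r i) (p i)})"
  have fin: "finite L" using finite_tiles by (simp add: L_def)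
  have "\<exists>x m. norm m = 1 \<and> l = {y. cross2 m (y - x) = 0}" if "l \<in> L" for l
  proof -
    from that obtain U V where "U \<noteq> V" "l = line_through U V"
      unfolding L_def using ccw_distinct[OF big_ccw] ccw_distinct[OF tile_ccw] by blast
    then show ?thesis using line_unit_direction by blast
  qed
  then obtain x m where m: "\<And>l. l \<in> L \<Longrightarrow> norm (m l) = 1 \<and> l = {y. cross2 (m l) (y - x l) = 0}"
    by metis
  have "(\<Sum>i\<in>I. boundary_weight f (p i) (q i) (r i))
     = (\<Sum>i\<in>I. \<Sum>l\<in>L. f (to_complex (m l)) * signed_boundary_on_line (x l) (m l) (p i) (q i) (r i))"
  proof (rule sum.cong[OF refl])
    fix i assume i: "i \<in> I"
    show "boundary_weight f (p i) (q i) (r i)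
     = (\<Sum>l\<in>L. f (to_complex (m l)) * signed_boundary_on_line (x l) (m l) (p i) (q i) (r i))"
      by (rule boundary_weight_by_lines[of f, OF odd tile_ccw[OF i] fin]) (use i m in \<open>auto simp: L_def\<close>)
  qed
  also have "\<dots> = (\<Sum>l\<in>L. f (to_complex (m l)) * (\<Sum>i\<in>I. signed_boundary_on_line (x l) (m l) (p i) (q i) (r i)))"
    by (subst sum.swap) (simp add: sum_distrib_left)
  also have "\<dots> = (\<Sum>l\<in>L. f (to_complex (m l)) * signed_boundary_on_line (x l) (m l) A B C)"
    using m line_balance by (intro sum.cong refl) metis
  also have "\<dots> = boundary_weight f A B C"
    by (rule boundary_weight_by_lines[of f, OF odd big_ccw fin, symmetric]) (use m in \<open>auto simp: L_def\<close>)
  finally show ?thesis .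
qed

end

section \<open>Edge directions as rotations, and the sign character\<close>

lemma lagrange_identity_2:
  "(inner u v)\<^sup>2 + (cross2 u v)\<^sup>2 = (norm u)\<^sup>2 * (norm v)\<^sup>2"
  unfolding power2_norm_eq_inner by (simp add: inner_2 cross2_def power2_eq_square algebra_simps)

text \<open>As complex numbers, $v/u$ has real part proportional to the inner product and imaginary part
  proportional to the cross product. The former fixes the angle up to its sign, the latter
  fixes the sign.\<close>

lemma turn_direction:
  assumes \<sigma>: "\<sigma> = 1 \<or> \<sigma> = -1" and pos: "\<sigma> * cross2 u v > 0"
    and c: "inner u v = norm u * norm v * cos t" and s: "sin t \<ge> 0"
  shows "to_complex v / of_real (norm v) = to_complex u / of_real (norm u) * cis (\<sigma> * t)"
proof -
  have uv: "norm u > 0" "norm v > 0" using pos by (auto simp: cross2_def)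
  have "(\<sigma> * cross2 u v)\<^sup>2 = (cross2 u v)\<^sup>2" using \<sigma> by auto
  also have "\<dots> = (norm u)\<^sup>2 * (norm v)\<^sup>2 - (norm u * norm v * cos t)\<^sup>2"
    using lagrange_identity_2[of u v] c by simp
  also have "\<dots> = (norm u * norm v * sin t)\<^sup>2"
    by (simp add: power_mult_distrib sin_squared_eq algebra_simps)
  finally have "\<sigma> * cross2 u v = norm u * norm v * sin t"
    using pos s uv by (simp add: power2_eq_iff_nonneg)
  then have x: "cross2 u v = \<sigma> * (norm u * norm v * sin t)" using \<sigma> by auto
  have uu: "norm u * norm u = u $ 1 * u $ 1 + u $ 2 * u $ 2"
    using power2_norm_eq_inner[of u] by (simp add: inner_2 power2_eq_square)
  have "to_complex u * Complex (inner u v) (cross2 u v) = of_real (norm u * norm u) * to_complex v"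
    unfolding uu by (simp add: to_complex_def complex_eq_iff inner_2 cross2_def algebra_simps)
  moreover have "Complex (inner u v) (cross2 u v) = of_real (norm u * norm v) * cis (\<sigma> * t)"
    using \<sigma> by (auto simp: complex_eq_iff c x)
  ultimately have "of_real (norm u) * (to_complex u * of_real (norm v) * cis (\<sigma> * t))
     = of_real (norm u) * (of_real (norm u) * to_complex v)" by (simp add: algebra_simps)
  then have "to_complex u * of_real (norm v) * cis (\<sigma> * t) = of_real (norm u) * to_complex v"
    using uv by simp
  then show ?thesis using uv by (simp add: field_simps)
qed

lemma edge_dir_turn:
  assumes "\<sigma> = 1 \<or> \<sigma> = -1" and "\<sigma> * cross2 (V - U) (W - U) > 0"
    and "inner (V - U) (W - U) = dist U V * dist U W * cos t" and "sin t \<ge> 0"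
  shows "edge_dir U W = edge_dir U V * cis (\<sigma> * t)"
  using turn_direction[OF assms(1,2) _ assms(4)] assms(3)
  by (simp add: edge_dir_def dist_norm norm_minus_commute)

lemma edge_dir_reverse: "edge_dir V U = - edge_dir U V"
proof -
  have "to_complex (U - V) = - to_complex (V - U)" by (simp add: to_complex_def complex_eq_iff)
  then show ?thesis by (simp add: edge_dir_def dist_commute)
qed

lemma inner_at_vertex:
  fixes U V W :: "real^2"
  shows "2 * inner (V - U) (W - U) = (dist U V)\<^sup>2 + (dist U W)\<^sup>2 - (dist V W)\<^sup>2"
  by (simp add: dist_norm power2_norm_eq_inner inner_diff_left inner_diff_right inner_commute)

text \<open>The relation "\<^term>\<open>d\<close> arises from \<^term>\<open>d\<^sub>0\<close> by a rotation about $k\alpha + m\pi/3$ with $(-1)^{m+tk}$ of the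
  given sign". Only the parity of \<^term>\<open>t\<close> matters. As a relation it obeys the rotation rule
  below for every $\alpha$; irrationality of $\alpha/\pi$ is what makes the two signs exclude each other at \<^term>\<open>d\<^sub>0\<close>.\<close>

definition rotation_sign :: "real \<Rightarrow> complex \<Rightarrow> int \<Rightarrow> bool \<Rightarrow> complex \<Rightarrow> bool" where
  "rotation_sign \<alpha> d\<^sub>0 t e d \<longleftrightarrow>
     (\<exists>k m :: int. d = d\<^sub>0 * cis (k * \<alpha> + m * (pi / 3)) \<and> (even (m + t * k) = e))"

definition rotation_char :: "real \<Rightarrow> complex \<Rightarrow> int \<Rightarrow> complex \<Rightarrow> real" where
  "rotation_char \<alpha> d\<^sub>0 t d = of_bool (rotation_sign \<alpha> d\<^sub>0 t True d) - of_bool (rotation_sign \<alpha> d\<^sub>0 t False d)"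

text \<open>A further rotation about $i\alpha + j\pi/3$ shifts the exponents $k, m$ by $i, j$, hence multiplies the
  sign by $(-1)^{j+ti}$.\<close>

lemma rotation_sign_mult:
  fixes \<alpha> :: real and i j :: int
  shows "rotation_sign \<alpha> d\<^sub>0 t e (d * cis (i * \<alpha> + j * (pi / 3))) \<longleftrightarrow> rotation_sign \<alpha> d\<^sub>0 t (e = even (j + t * i)) d"
proof
  assume "rotation_sign \<alpha> d\<^sub>0 t e (d * cis (i * \<alpha> + j * (pi / 3)))"
  then obtain k m :: int where km: "d * cis (i * \<alpha> + j * (pi / 3)) = d\<^sub>0 * cis (k * \<alpha> + m * (pi / 3))"
    "even (m + t * k) = e" unfolding rotation_sign_def by blast
  have "d = (d * cis (i * \<alpha> + j * (pi / 3))) * cis (- (i * \<alpha> + j * (pi / 3)))"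
    by (simp add: mult.assoc cis_mult)
  also have "\<dots> = d\<^sub>0 * cis (of_int (k - i) * \<alpha> + of_int (m - j) * (pi / 3))"
    unfolding km(1) by (simp add: mult.assoc cis_mult algebra_simps add_divide_distrib diff_divide_distrib)
  finally have "d = d\<^sub>0 * cis (of_int (k - i) * \<alpha> + of_int (m - j) * (pi / 3))" .
  moreover have "even ((m - j) + t * (k - i)) = (e = even (j + t * i))"
    using km(2) by (auto simp: algebra_simps)
  ultimately show "rotation_sign \<alpha> d\<^sub>0 t (e = even (j + t * i)) d" unfolding rotation_sign_def by blast
next
  assume "rotation_sign \<alpha> d\<^sub>0 t (e = even (j + t * i)) d"
  then obtain k m :: int where km: "d = d\<^sub>0 * cis (k * \<alpha> + m * (pi / 3))"
    "even (m + t * k) = (e = even (j + t * i))" unfolding rotation_sign_def by blast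
  have "d * cis (i * \<alpha> + j * (pi / 3)) = d\<^sub>0 * cis (of_int (k + i) * \<alpha> + of_int (m + j) * (pi / 3))"
    unfolding km(1) by (simp add: mult.assoc cis_mult algebra_simps add_divide_distrib)
  moreover have "even ((m + j) + t * (k + i)) = e"
    using km(2) by (auto simp: algebra_simps)
  ultimately show "rotation_sign \<alpha> d\<^sub>0 t e (d * cis (i * \<alpha> + j * (pi / 3)))"
    unfolding rotation_sign_def by blast
qed

lemma rotation_char_mult:
  fixes \<alpha> :: real and i j :: int
  shows "rotation_char \<alpha> d\<^sub>0 t (d * cis (i * \<alpha> + j * (pi / 3)))
     = (if even (j + t * i) then 1 else -1) * rotation_char \<alpha> d\<^sub>0 t d"
proof -
  obtain b where b: "even (j + t * i) = b" by blast
  show ?thesis unfolding rotation_char_def rotation_sign_mult b by (cases b) simp_all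
qed

text \<open>Reversal is the rotation about $3 \cdot \pi/3$, and $3$ is odd.\<close>

lemma rotation_char_minus: "rotation_char \<alpha> d\<^sub>0 t (- d) = - rotation_char \<alpha> d\<^sub>0 t d"
  using rotation_char_mult[of \<alpha> d\<^sub>0 t d 0 3] by simp

lemma rotation_char_Ints: "rotation_char \<alpha> d\<^sub>0 t d \<in> \<int>"
  by (simp add: rotation_char_def)

lemma cis_eq_1_irrational:
  fixes \<alpha> :: real and k m :: int
  assumes irr: "\<alpha> / pi \<notin> \<rat>" and "cis (k * \<alpha> + m * (pi / 3)) = 1"
  shows "k = 0 \<and> even m"
proof -
  obtain n :: int where n: "k * \<alpha> + m * (pi / 3) = n * (2 * pi)"
    using assms(2) by (auto simp: cis_conv_exp exp_eq_1)
  then have eq: "k * (\<alpha> / pi) = 2 * n - m / 3" by (simp add: field_simps)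
  have k: "k = 0"
  proof (rule ccontr)
    assume "k \<noteq> 0"
    with eq have "\<alpha> / pi = (2 * n - m / 3) / k" by (simp add: field_simps)
    then have "\<alpha> / pi \<in> \<rat>" by (metis Rats_diff Rats_divide Rats_mult Rats_number_of Rats_of_int)
    with irr show False by blast
  qed
  with eq have "real_of_int m = real_of_int (6 * n)" by simp
  then have "m = 6 * n" by (simp only: of_int_eq_iff)
  with k show ?thesis by simp
qed

lemma rotation_char_base:
  assumes "\<alpha> / pi \<notin> \<rat>" "d\<^sub>0 \<noteq> 0"
  shows "rotation_char \<alpha> d\<^sub>0 t d\<^sub>0 = 1"
proof -
  have "rotation_sign \<alpha> d\<^sub>0 t True d\<^sub>0"
    unfolding rotation_sign_def by (intro exI[of _ 0]) simp
  moreover have "\<not> rotation_sign \<alpha> d\<^sub>0 t False d\<^sub>0"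
  proof
    assume "rotation_sign \<alpha> d\<^sub>0 t False d\<^sub>0"
    then obtain k m :: int where km: "d\<^sub>0 = d\<^sub>0 * cis (k * \<alpha> + m * (pi / 3))" "odd (m + t * k)"
      unfolding rotation_sign_def by blast
    then have "cis (k * \<alpha> + m * (pi / 3)) = 1" using assms(2) by simp
    from cis_eq_1_irrational[OF assms(1) this] km(2) show False by simp
  qed
  ultimately show ?thesis by (simp add: rotation_char_def)
qed

section \<open>Signed boundary lengths of the tile and of the isosceles triangle\<close>

text \<open>The metric content of having the angles $\alpha$ and $2\pi/3$. The third angle is
  $\pi/3 - \alpha$.\<close>

locale tile_shape =
  fixes a b c \<alpha> :: real
  assumes pos: "a > 0" "b > 0" "c > 0"
    and law: "c\<^sup>2 = a\<^sup>2 + a * b + b\<^sup>2"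
    and cos_\<alpha>: "cos \<alpha> = (2 * b + a) / (2 * c)"
    and sin_\<alpha>: "sin \<alpha> = sqrt 3 * a / (2 * c)"
begin

lemma cos_complement: "cos (pi / 3 - \<alpha>) = (2 * a + b) / (2 * c)"
proof -
  have "sqrt 3 / 2 * (sqrt 3 * a / (2 * c)) = 3 * a / (4 * c)" by simp
  then show ?thesis unfolding cos_diff cos_60 sin_60 cos_\<alpha> sin_\<alpha>
    using pos by (simp add: field_simps)
qed

lemma sin_complement: "sin (pi / 3 - \<alpha>) = sqrt 3 * b / (2 * c)"
  unfolding sin_diff cos_60 sin_60 cos_\<alpha> sin_\<alpha> using pos by (simp add: field_simps)

text \<open>Seen from $P$, the edge $PR$ is $PQ$ turned by $\alpha$; seen from $Q$, the edge $QR$ is $QP$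
  turned by $\pi/3 - \alpha$ the other way. The sign $\sigma$ is the orientation of the triangle, which
  distinguishes a tile from its mirror image.\<close>

lemma tile_edge_dirs:
  assumes dist: "dist Q R = a" "dist P R = b" "dist P Q = c"
    and \<sigma>: "\<sigma> = 1 \<or> \<sigma> = -1" and or: "\<sigma> * cross2 (Q - P) (R - P) > 0"
  shows "edge_dir P R = edge_dir P Q * cis (\<sigma> * \<alpha>)"
    and "edge_dir Q R = - edge_dir P Q * cis (\<sigma> * (\<alpha> - pi / 3))"
proof -
  have "2 * inner (Q - P) (R - P) = 2 * (c * b * cos \<alpha>)"
    using law pos unfolding inner_at_vertex dist cos_\<alpha> by (simp add: field_simps power2_eq_square)
  then show "edge_dir P R = edge_dir P Q * cis (\<sigma> * \<alpha>)"
    using edge_dir_turn[OF \<sigma> or, of \<alpha>] pos by (simp add: dist sin_\<alpha>)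
  have or': "(- \<sigma>) * cross2 (P - Q) (R - Q) > 0"
    using or by (simp add: cross2_def algebra_simps)
  have "2 * inner (P - Q) (R - Q) = 2 * (c * a * cos (pi / 3 - \<alpha>))"
    using law pos unfolding inner_at_vertex dist cos_complement dist_commute[of Q P]
    by (simp add: field_simps power2_eq_square)
  then have "edge_dir Q R = edge_dir Q P * cis (- \<sigma> * (pi / 3 - \<alpha>))"
    using edge_dir_turn[of "- \<sigma>", OF _ or', of "pi / 3 - \<alpha>"] \<sigma> pos
    by (auto simp: dist dist_commute[of Q P] sin_complement)
  then show "edge_dir Q R = - edge_dir P Q * cis (\<sigma> * (\<alpha> - pi / 3))"
    by (simp add: edge_dir_reverse[of Q P] algebra_simps)
qed

text \<open>Both orientations give the same multiple of the direction of the longest side: reflecting the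
  tile replaces its turns by their inverses, which does not change the signs.\<close>

lemma tile_boundary_weight:
  fixes t :: int
  defines "s \<equiv> (if even t then 1 else -1)"
  assumes dist: "dist Q R = a" "dist P R = b" "dist P Q = c"
  shows "ccw P Q R \<Longrightarrow> boundary_weight (rotation_char \<alpha> d\<^sub>0 t) P Q R
      = rotation_char \<alpha> d\<^sub>0 t (edge_dir P Q) * (c + s * (a - b))"
    and "ccw Q P R \<Longrightarrow> boundary_weight (rotation_char \<alpha> d\<^sub>0 t) Q P R
      = rotation_char \<alpha> d\<^sub>0 t (edge_dir Q P) * (c + s * (a - b))"
proof -
  let ?f = "rotation_char \<alpha> d\<^sub>0 t"
  have f1: "?f (d * cis (\<sigma> * \<alpha>)) = s * ?f d" if "\<sigma> = 1 \<or> \<sigma> = -1" for d \<sigma>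
    using rotation_char_mult[of \<alpha> d\<^sub>0 t d 1 0] rotation_char_mult[of \<alpha> d\<^sub>0 t d "-1" 0] that
    by (auto simp: s_def)
  have f2: "?f (d * cis (\<sigma> * (\<alpha> - pi / 3))) = - (s * ?f d)" if "\<sigma> = 1 \<or> \<sigma> = -1" for d \<sigma>
    using rotation_char_mult[of \<alpha> d\<^sub>0 t d 1 "-1"] rotation_char_mult[of \<alpha> d\<^sub>0 t d "-1" 1] that
    by (auto simp: s_def algebra_simps)
  note w = boundary_weight_def edge_weight_def dist dist_commute[of R P] dist_commute[of Q P]
     dist_commute[of R Q] edge_dir_reverse[of R P] edge_dir_reverse[of R Q] edge_dir_reverse[of Q P]
     rotation_char_minus
  have sig: "(1 :: real) = 1 \<or> (1 :: real) = -1" "(-1 :: real) = 1 \<or> (-1 :: real) = -1" by auto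
  {
    assume "ccw P Q R"
    then have "1 * cross2 (Q - P) (R - P) > 0" by simp
    note e = tile_edge_dirs[OF dist sig(1) this]
    show "boundary_weight ?f P Q R = ?f (edge_dir P Q) * (c + s * (a - b))"
      unfolding w e f1[OF sig(1)] f2[OF sig(1)] by (simp add: algebra_simps)
  next
    assume "ccw Q P R"
    then have "- 1 * cross2 (Q - P) (R - P) > 0" by (simp add: cross2_def algebra_simps)
    note e = tile_edge_dirs[OF dist sig(2) this]
    show "boundary_weight ?f Q P R = ?f (edge_dir Q P) * (c + s * (a - b))"
      unfolding w e f1[OF sig(2)] f2[OF sig(2)] by (simp add: algebra_simps)
  }
qed

end

text \<open>Base $AC$ and apex $B$, listed counterclockwise as $A, C, B$. As tiles may be
  reflected, either order of the first two vertices of a tile can be the one that matches the tile.\<close>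

locale isosceles_tiling = triangle_tiling I p q r A C B + tile_shape a b c \<alpha>
  for I :: "'i set" and p q r A B C a b c \<alpha> +
  fixes X Y :: real
  assumes tile_dist: "i \<in> I \<Longrightarrow>
      (\<exists>P Q. {P, Q} = {p i, q i} \<and> dist Q (r i) = a \<and> dist P (r i) = b \<and> dist P Q = c)"
    and legs: "dist A B = X" "dist B C = X" and base: "dist A C = Y"
    and Y_eq: "Y = 2 * X * cos \<alpha>"
    and irrational: "\<alpha> / pi \<notin> \<rat>"
begin

lemma big_edge_dirs:
  "edge_dir B A = - edge_dir A C * cis \<alpha>" "edge_dir C B = - edge_dir A C * cis (- \<alpha>)"
proof -
  have sig: "(1 :: real) = 1 \<or> (1 :: real) = -1" "(-1 :: real) = 1 \<or> (-1 :: real) = -1" by auto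
  have "2 * inner (C - A) (B - A) = 2 * (Y * X * cos \<alpha>)"
    unfolding inner_at_vertex base legs dist_commute[of C B] Y_eq by (simp add: power2_eq_square)
  then have "edge_dir A B = edge_dir A C * cis (1 * \<alpha>)"
    using edge_dir_turn[OF sig(1), of C A B \<alpha>] big_ccw pos by (simp add: legs base sin_\<alpha>)
  then show "edge_dir B A = - edge_dir A C * cis \<alpha>" by (simp add: edge_dir_reverse[of B A])
  have "2 * inner (A - C) (B - C) = 2 * (Y * X * cos \<alpha>)"
    unfolding inner_at_vertex base legs dist_commute[of C B] dist_commute[of C A] Y_eq
    by (simp add: power2_eq_square)
  moreover have "-1 * cross2 (A - C) (B - C) > 0" using big_ccw by (simp add: cross2_def algebra_simps)
  ultimately have "edge_dir C B = edge_dir C A * cis (-1 * \<alpha>)"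
    using edge_dir_turn[OF sig(2), of A C B \<alpha>] pos
    by (simp add: legs base sin_\<alpha> dist_commute[of C])
  then show "edge_dir C B = - edge_dir A C * cis (- \<alpha>)" by (simp add: edge_dir_reverse[of C A])
qed

lemma base_dir_nonzero: "edge_dir A C \<noteq> 0"
proof -
  have "A \<noteq> C" using ccw_distinct[OF big_ccw] by blast
  then show ?thesis by (auto simp: edge_dir_def to_complex_def complex_eq_iff vec_eq_iff forall_2)
qed

text \<open>The characters $(-1)^m$ and $(-1)^{m+k}$, for even and odd \<^term>\<open>t\<close>, applied to
  \<open>edge_balance\<close>. Every tile contributes an integer multiple of the same number. In the big triangle the
  base has value $1$, and both legs have the direction $-d_0 e^{\pm i\alpha}$.\<close>

lemma signed_boundary_relation:
  fixes t :: int
  shows "\<exists>M :: int. Y - 2 * (if even t then 1 else -1) * X = M * (c + (if even t then 1 else -1) * (a - b))"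
proof -
  define s :: real where "s = (if even t then 1 else -1)"
  let ?f = "rotation_char \<alpha> (edge_dir A C) t"
  have "\<exists>k \<in> \<int>. boundary_weight ?f (p i) (q i) (r i) = k * (c + s * (a - b))" if i: "i \<in> I" for i
  proof -
    obtain P Q where PQ: "{P, Q} = {p i, q i}" "dist Q (r i) = a" "dist P (r i) = b" "dist P Q = c"
      using tile_dist[OF i] by blast
    then consider "p i = P" "q i = Q" | "p i = Q" "q i = P" by (auto simp: doubleton_eq_iff)
    then show ?thesis
    proof cases
      case 1
      then show ?thesis using tile_boundary_weight(1)[OF PQ(2-4), of _ t] tile_ccw[OF i] rotation_char_Ints
        unfolding s_def by metis
    next
      case 2
      then show ?thesis using tile_boundary_weight(2)[OF PQ(2-4), of _ t] tile_ccw[OF i] rotation_char_Ints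
        unfolding s_def by metis
    qed
  qed
  then obtain k where k: "\<And>i. i \<in> I \<Longrightarrow> k i \<in> \<int>"
    "\<And>i. i \<in> I \<Longrightarrow> boundary_weight ?f (p i) (q i) (r i) = k i * (c + s * (a - b))" by metis
  have "boundary_weight ?f A C B = (\<Sum>i\<in>I. boundary_weight ?f (p i) (q i) (r i))"
    by (rule edge_balance[symmetric]) (rule rotation_char_minus)
  also have "\<dots> = (\<Sum>i\<in>I. k i) * (c + s * (a - b))"
    using k(2) by (simp add: sum_distrib_right)
  finally have w: "boundary_weight ?f A C B = (\<Sum>i\<in>I. k i) * (c + s * (a - b))" .
  have f0: "?f (edge_dir A C) = 1" by (rule rotation_char_base[OF irrational base_dir_nonzero])
  have "?f (edge_dir C B) = - s" "?f (edge_dir B A) = - s"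
    unfolding big_edge_dirs
    using rotation_char_mult[of \<alpha> "edge_dir A C" t "- edge_dir A C" 1 0]
      rotation_char_mult[of \<alpha> "edge_dir A C" t "- edge_dir A C" "-1" 0]
    by (simp_all add: rotation_char_minus f0 s_def)
  then have "boundary_weight ?f A C B = Y - 2 * s * X"
    by (simp add: boundary_weight_def edge_weight_def f0 base legs dist_commute[of C B] dist_commute[of B A])
  moreover have "(\<Sum>i\<in>I. k i) \<in> \<int>" using k(1) by (intro Ints_sum) auto
  ultimately show ?thesis using w unfolding s_def by (metis Ints_cases)
qed

text \<open>Here \<open>edge_balance\<close> counts only edges parallel to the leg $AB$. Tiles contribute signed
  tile sides; the other two sides of the big triangle contribute nothing, because they would be parallel to
  $AB$ only if $\alpha$ were a rational multiple of $\pi$.\<close>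

lemma leg_integer_combination:
  "\<exists>(k :: int) (l :: int) (m :: int). X = k * a + l * b + m * c"
proof -
  let ?d = "edge_dir B A"
  let ?f = "\<lambda>d. of_bool (d = ?d) - of_bool (d = - ?d) :: real"
  let ?Comb = "{x. \<exists>(k :: int) (l :: int) (m :: int). x = k * a + l * b + m * c}"
  have odd: "?f (- d) = - ?f d" for d
  proof -
    have "- d = ?d \<longleftrightarrow> d = - ?d" by (metis minus_minus)
    then show ?thesis by simp
  qed
  have add: "x + y \<in> ?Comb" if xy: "x \<in> ?Comb" "y \<in> ?Comb" for x y
  proof -
    obtain k l m k' l' m' :: int where "x = k * a + l * b + m * c" "y = k' * a + l' * b + m' * c"
      using xy by blast
    then have "x + y = of_int (k + k') * a + of_int (l + l') * b + of_int (m + m') * c"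
      by (simp add: algebra_simps)
    then show ?thesis by blast
  qed
  have edge: "edge_weight ?f U V \<in> ?Comb" if "dist U V \<in> {a, b, c}" for U V
  proof -
    have "?f (edge_dir U V) \<in> \<int>" by simp
    then obtain n :: int where n: "?f (edge_dir U V) = of_int n" by (metis Ints_cases)
    from that consider "dist U V = a" | "dist U V = b" | "dist U V = c" by blast
    then show ?thesis
    proof cases
      case 1 then show ?thesis unfolding edge_weight_def n
        by (intro CollectI exI[of _ n] exI[of _ 0]) simp
    next
      case 2 then show ?thesis unfolding edge_weight_def n
        by (intro CollectI exI[of _ 0] exI[of _ n] exI[of _ 0]) simp
    next
      case 3 then show ?thesis unfolding edge_weight_def n
        by (intro CollectI exI[of _ 0] exI[of _ n]) simp
    qed
  qed
  have tile: "boundary_weight ?f (p i) (q i) (r i) \<in> ?Comb" if i: "i \<in> I" for i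
  proof -
    obtain P Q where PQ: "{P, Q} = {p i, q i}" "dist Q (r i) = a" "dist P (r i) = b" "dist P Q = c"
      using tile_dist[OF i] by blast
    then consider "p i = P" "q i = Q" | "p i = Q" "q i = P" by (auto simp: doubleton_eq_iff)
    then have "dist (p i) (q i) \<in> {a, b, c} \<and> dist (q i) (r i) \<in> {a, b, c} \<and> dist (r i) (p i) \<in> {a, b, c}"
      by cases (use PQ in \<open>simp_all add: dist_commute\<close>)
    then show ?thesis unfolding boundary_weight_def by (intro add edge) auto
  qed
  have zero: "0 \<in> ?Comb" by (intro CollectI exI[of _ 0]) simp
  have sums: "sum g J \<in> ?Comb" if "finite J" "\<And>i. i \<in> J \<Longrightarrow> g i \<in> ?Comb" for g and J :: "'i set"
    using that
  proof (induction J rule: finite_induct)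
    case (insert j J)
    have "g j + sum g J \<in> ?Comb" by (intro add insert.IH insert.prems insertI1 insertI2)
    then show ?case unfolding sum.insert[OF insert.hyps] .
  qed (simp only: sum.empty zero)
  have "(\<Sum>i\<in>I. boundary_weight ?f (p i) (q i) (r i)) \<in> ?Comb"
    by (rule sums[OF finite_tiles tile])
  then have w: "boundary_weight ?f A C B \<in> ?Comb"
    using edge_balance[of ?f, OF odd] by simp
  have rot: "k = 0 \<and> even m" if "edge_dir A C * cis (of_int k * \<alpha> + of_int m * (pi / 3)) = edge_dir A C" for k m
    using cis_eq_1_irrational[OF irrational] that base_dir_nonzero by simp
  have neg: "cis (x + pi) = - cis x" for x by (simp add: cis_mult[symmetric])
  have "edge_dir A C * cis \<alpha> \<noteq> edge_dir A C" using rot[of 1 0] by auto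
  moreover have "- (edge_dir A C * cis \<alpha>) \<noteq> edge_dir A C" using rot[of 1 3] by (auto simp: neg)
  ultimately have "?f (edge_dir A C) = 0" by (auto simp: big_edge_dirs)
  moreover have "?f (edge_dir C B) = 0"
  proof -
    have "cis (- \<alpha>) = cis \<alpha> \<Longrightarrow> cis (2 * \<alpha>) = 1" "cis (- \<alpha>) = - cis \<alpha> \<Longrightarrow> cis (2 * \<alpha> + pi) = 1"
      using cis_mult[of \<alpha> \<alpha>] cis_mult[of "-\<alpha>" \<alpha>] by (auto simp: cis_mult[symmetric])
    then have ne1: "cis (- \<alpha>) \<noteq> cis \<alpha>" and ne2: "cis (- \<alpha>) \<noteq> - cis \<alpha>"
      using rot[of 2 0] rot[of 2 3] by auto
    from ne2 have ne2': "- cis (- \<alpha>) \<noteq> cis \<alpha>" by (metis minus_minus)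
    have "edge_dir A C * (- cis (- \<alpha>)) \<noteq> edge_dir A C * cis \<alpha>"
      using ne2' base_dir_nonzero unfolding mult_cancel_left by blast
    with ne1 base_dir_nonzero show ?thesis by (simp add: big_edge_dirs)
  qed
  moreover have "?d \<noteq> - ?d" using base_dir_nonzero by (simp add: big_edge_dirs)
  ultimately have "boundary_weight ?f A C B = X"
    by (simp add: boundary_weight_def edge_weight_def legs dist_commute[of B A])
  with w show ?thesis by simp
qed

end

section \<open>Rationality of the side ratios\<close>

text \<open>Put $\rho = b/a$, $\kappa = c/a$ and $K = -M_1M_2$. The product of the two signed relations is
  $aX^2 = Kbc^2$; with the area relation this becomes $N = K(2\rho + 1)$, so $\rho$ is rational.
  The square of the second signed relation is quadratic in $\kappa$, but $\kappa^2 = 1 + \rho + \rho^2$ is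
  rational, so it reads $\kappa u = v$ with rational $u, v$. If $u$ vanished, then $v$ would too, and
  eliminating $K$ would give $\rho = -1$ or $M_2 = 0$; the latter forces $K\rho(2\rho + 1) = 0$.\<close>

lemma commensurable_sides:
  fixes a b c X Y :: real and M\<^sub>1 M\<^sub>2 :: int and N :: nat
  assumes pos: "a > 0" "b > 0" "c > 0" "X > 0"
    and law: "c\<^sup>2 = a\<^sup>2 + a * b + b\<^sup>2"
    and M1: "Y - 2 * X = M\<^sub>1 * (c + (a - b))" and M2: "Y + 2 * X = M\<^sub>2 * (c - (a - b))"
    and base: "Y * c = X * (2 * b + a)"
    and area: "N * b * c\<^sup>2 = X\<^sup>2 * (2 * b + a)"
  shows "b / a \<in> \<rat> \<and> c / a \<in> \<rat>"
proof -
  define K :: real where "K = - of_int (M\<^sub>1 * M\<^sub>2)"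
  define \<rho> where "\<rho> = b / a"
  define \<kappa> where "\<kappa> = c / a"
  have bc: "b = \<rho> * a" "c = \<kappa> * a" using pos by (simp_all add: \<rho>_def \<kappa>_def)
  have rk: "\<rho> > 0" "\<kappa> > 0" using pos by (simp_all add: \<rho>_def \<kappa>_def)
  have rat: "K \<in> \<rat>" "real N \<in> \<rat>" "of_int M\<^sub>2 \<in> \<rat>" by (simp_all add: K_def del: of_int_mult)
  have law': "\<kappa>\<^sup>2 = 1 + \<rho> + \<rho>\<^sup>2"
  proof -
    have "\<kappa>\<^sup>2 * a\<^sup>2 = (1 + \<rho> + \<rho>\<^sup>2) * a\<^sup>2"
      using law unfolding bc by (simp add: algebra_simps power2_eq_square)
    then show ?thesis using pos by simp
  qed
  have "(Y - 2 * X) * (Y + 2 * X) = of_int (M\<^sub>1 * M\<^sub>2) * ((c + (a - b)) * (c - (a - b)))"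
    unfolding M1 M2 by simp
  also have "(c + (a - b)) * (c - (a - b)) = 3 * a * b"
    using law by (simp add: power2_eq_square algebra_simps)
  finally have "Y\<^sup>2 - 4 * X\<^sup>2 = - 3 * (K * a * b)"
    by (simp add: K_def power2_eq_square algebra_simps)
  then have "(Y * c)\<^sup>2 - 4 * X\<^sup>2 * c\<^sup>2 = - 3 * (K * a * b) * c\<^sup>2"
    by (simp add: power_mult_distrib flip: left_diff_distrib)
  then have "X\<^sup>2 * ((2 * b + a)\<^sup>2 - 4 * c\<^sup>2) = - 3 * (K * a * b) * c\<^sup>2"
    by (simp only: base power_mult_distrib right_diff_distrib mult_ac)
  moreover have "(2 * b + a)\<^sup>2 - 4 * c\<^sup>2 = - 3 * a * a"
    unfolding law by (simp add: power2_eq_square algebra_simps)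
  ultimately have "X\<^sup>2 * (- 3 * a * a) = - 3 * (K * a * b) * c\<^sup>2" by simp
  then have "a * (a * X\<^sup>2) = a * (K * b * c\<^sup>2)" by (simp add: mult_ac)
  then have K: "a * X\<^sup>2 = K * b * c\<^sup>2" using pos by simp
  have "K * (b * c\<^sup>2) > 0" using K pos by (metis mult.assoc mult_pos_pos zero_less_power)
  moreover have "b * c\<^sup>2 > 0" using pos by simp
  ultimately have Kpos: "K > 0" by (rule zero_less_mult_pos2)
  have "(N * a) * (b * c\<^sup>2) = (a * X\<^sup>2) * (2 * b + a)" using area by (simp add: algebra_simps)
  also have "\<dots> = (K * (2 * b + a)) * (b * c\<^sup>2)" unfolding K by (simp add: algebra_simps)
  finally have "N * a = K * (2 * b + a)" using pos by simp
  then have "a * real N = a * (K * (2 * \<rho> + 1))" unfolding bc by (simp add: algebra_simps)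
  then have "N = K * (2 * \<rho> + 1)" using pos by simp
  then have "\<rho> = (N - K) / (2 * K)" using Kpos by (simp add: field_simps)
  then have \<rho>: "\<rho> \<in> \<rat>" using rat by simp
  have "X * (2 * c + 2 * b + a) = c * (Y + 2 * X)" using base by (simp add: algebra_simps)
  also have "\<dots> = c * (of_int M\<^sub>2 * (c - (a - b)))" unfolding M2 ..
  finally have "(X * (2 * c + 2 * b + a))\<^sup>2 = (c * (of_int M\<^sub>2 * (c - (a - b))))\<^sup>2" by simp
  then have "(a * X\<^sup>2) * (2 * c + 2 * b + a)\<^sup>2 = a * (c\<^sup>2 * ((of_int M\<^sub>2)\<^sup>2 * (c - (a - b))\<^sup>2))"
    by (simp add: power_mult_distrib)
  then have "c\<^sup>2 * (K * b * (2 * c + 2 * b + a)\<^sup>2) = c\<^sup>2 * (a * (of_int M\<^sub>2)\<^sup>2 * (c - (a - b))\<^sup>2)"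
    unfolding K by (simp add: algebra_simps)
  then have "K * b * (2 * c + 2 * b + a)\<^sup>2 = a * (of_int M\<^sub>2)\<^sup>2 * (c - (a - b))\<^sup>2"
    using pos by simp
  then have "a ^ 3 * (K * \<rho> * (2 * \<kappa> + 2 * \<rho> + 1)\<^sup>2) = a ^ 3 * ((of_int M\<^sub>2)\<^sup>2 * (\<kappa> - 1 + \<rho>)\<^sup>2)"
    unfolding bc by (simp add: power2_eq_square power3_eq_cube algebra_simps)
  then have sq: "K * \<rho> * (2 * \<kappa> + 2 * \<rho> + 1)\<^sup>2 = (of_int M\<^sub>2)\<^sup>2 * (\<kappa> - 1 + \<rho>)\<^sup>2"
    using pos by simp
  define m where "m = (real_of_int M\<^sub>2)\<^sup>2"
  define u where "u = 4 * K * \<rho> * (2 * \<rho> + 1) - 2 * m * (\<rho> - 1)"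
  define v where "v = m * (\<kappa>\<^sup>2 + (\<rho> - 1)\<^sup>2) - K * \<rho> * (4 * \<kappa>\<^sup>2 + (2 * \<rho> + 1)\<^sup>2)"
  have lin: "\<kappa> * u = v" using sq unfolding u_def v_def m_def
    by (simp add: power2_eq_square algebra_simps)
  have "u \<noteq> 0"
  proof
    assume u0: "u = 0"
    then have "v = 0" using lin by simp
    \<comment> \<open>The combination of the equations u = 0 and v = 0 from which K cancels.\<close>
    have "2 * m * (2 * (2 * \<rho> + 1) * (\<kappa>\<^sup>2 + (\<rho> - 1)\<^sup>2) - (\<rho> - 1) * (4 * \<kappa>\<^sup>2 + (2 * \<rho> + 1)\<^sup>2))
       = 4 * (2 * \<rho> + 1) * v + u * (4 * \<kappa>\<^sup>2 + (2 * \<rho> + 1)\<^sup>2)"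
      by (simp add: u_def v_def algebra_simps)
    also have "\<dots> = 0" using u0 \<open>v = 0\<close> by simp
    also have "2 * (2 * \<rho> + 1) * (\<kappa>\<^sup>2 + (\<rho> - 1)\<^sup>2) - (\<rho> - 1) * (4 * \<kappa>\<^sup>2 + (2 * \<rho> + 1)\<^sup>2) = 9 * (\<rho> + 1)"
      unfolding law' by (simp add: power2_eq_square algebra_simps)
    finally have "m = 0" using rk by simp
    with u0 have "K * \<rho> * (2 * \<rho> + 1) = 0" by (simp add: u_def)
    with Kpos rk show False by simp
  qed
  moreover have "u \<in> \<rat>" "v \<in> \<rat>" unfolding u_def v_def law' m_def using rat \<rho> by simp_all
  moreover have "\<kappa> = v / u" using lin \<open>u \<noteq> 0\<close> by (simp add: field_simps)
  ultimately have "\<kappa> \<in> \<rat>" by simp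
  with \<rho> show ?thesis by (simp add: \<rho>_def \<kappa>_def)
qed

lemma coprime_integer_multiple:
  fixes a b c :: real
  assumes pos: "a > 0" "b > 0" "c > 0" and rat: "b / a \<in> \<rat>" "c / a \<in> \<rat>"
  shows "\<exists>s k l m. s > 0 \<and> Gcd {k, l, m :: nat} = 1 \<and> s * a = real k \<and> s * b = real l \<and> s * c = real m"
proof -
  obtain p q where pq: "q \<noteq> 0" "b / a = real p / real q" 
    using Rats_abs_nat_div_natE[OF rat(1)] pos by (metis abs_of_pos divide_pos_pos)
  obtain p' q' where pq': "q' \<noteq> 0" "c / a = real p' / real q'" 
    using Rats_abs_nat_div_natE[OF rat(2)] pos by (metis abs_of_pos divide_pos_pos)
  define x y w where "x = q * q'" and "y = p * q'" and "w = p' * q"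
  define g where "g = gcd x (gcd y w)"
  have x0: "x > 0" using pq(1) pq'(1) by (simp add: x_def)
  then have g0: "g > 0" by (simp add: g_def)
  have "g dvd x" "g dvd y" "g dvd w" 
    unfolding g_def by (meson gcd_dvd1 gcd_dvd2 dvd_trans)+
  then obtain k l m where klm: "x = g * k" "y = g * l" "w = g * m" by (auto elim!: dvdE)
  have "g * gcd k (gcd l m) = g" 
    using g_def unfolding klm by (simp add: gcd_mult_distrib_nat)
  then have "Gcd {k, l, m} = 1" using g0 by simp
  moreover define s where "s = real k / a"
  have k0: "k > 0" using x0 klm by (cases k) auto
  moreover have "s > 0" using k0 pos by (simp add: s_def)
  moreover have "s * a = real k" using pos by (simp add: s_def)
  moreover have "real x * (b / a) = real y" "real x * (c / a) = real w"
    using pq pq' by (simp_all add: x_def y_def w_def)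
  then have "real g * (s * b) = real g * real l" "real g * (s * c) = real g * real m"
    by (simp_all add: klm s_def mult_ac)
  then have "s * b = real l" "s * c = real m" using g0 by simp_all
  ultimately show ?thesis by blast
qed

section \<open>The Diophantine problem\<close>

text \<open>A common prime $p$ has $p^2$ dividing both terms on the left of $4c^2 - (2b+a)^2 = 3a^2$, so it divides
  $a$, even if $p = 3$; then it also divides $b$.\<close>

lemma coprime_longest_side:
  fixes a b c :: nat
  assumes law: "c\<^sup>2 = a\<^sup>2 + a * b + b\<^sup>2" and cop: "coprime a b"
  shows "coprime c (2 * b + a)"
proof (rule ccontr)
  assume "\<not> coprime c (2 * b + a)"
  then obtain p where p: "prime p" "p dvd c" "p dvd 2 * b + a"
    using prime_factor_nat[of "gcd c (2 * b + a)"] by (auto simp: coprime_iff_gcd_eq_1)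
  have eq: "4 * c\<^sup>2 = (2 * b + a)\<^sup>2 + 3 * a\<^sup>2" unfolding law by (simp add: power2_eq_square algebra_simps)
  have "p\<^sup>2 dvd 4 * c\<^sup>2" "p\<^sup>2 dvd (2 * b + a)\<^sup>2"
    using p by (auto intro: dvd_mult simp only: dvd_power_same)
  then have d: "p\<^sup>2 dvd 3 * a\<^sup>2" unfolding eq by (simp add: dvd_add_right_iff)
  have "p dvd a"
  proof (cases "p = 3")
    case True
    then have "3 dvd a\<^sup>2" using d by (simp add: power2_eq_square)
    then show ?thesis using True p(1) prime_dvd_power by blast
  next
    case False
    have "prime (3 :: nat)" by simp
    then have "\<not> p dvd 3" using False p(1) primes_dvd_imp_eq by blast
    moreover have "p dvd 3 * a\<^sup>2" using d by (metis dvd_trans dvd_triv_left power2_eq_square)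
    ultimately show ?thesis using p(1) prime_dvd_mult_iff prime_dvd_power by blast
  qed
  moreover have "p dvd c\<^sup>2" using p(2) by (simp add: power2_eq_square)
  then have "p dvd b\<^sup>2" unfolding law using \<open>p dvd a\<close>
    by (metis dvd_add_right_iff dvd_add dvd_mult2 power2_eq_square)
  then have "p dvd b" using p(1) prime_dvd_power by blast
  ultimately have "p dvd 1" using cop by (metis coprime_common_divisor dvd_refl is_unit_gcd gcd_greatest coprime_iff_gcd_eq_1)
  with p(1) show False by simp
qed


text \<open>Since $c$ is coprime to $2b + a$, all of $c^2$ divides $x^2$; since $b$ is, all of $b$ then divides $t^2$.\<close>

lemma tile_search_bounds:
  fixes N a b c x :: nat
  assumes pos: "a > 0" "b > 0" "c > 0" "x > 0"
    and law: "c\<^sup>2 = a\<^sup>2 + a * b + b\<^sup>2" and gcd1: "Gcd {a, b, c} = 1"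
    and area: "N * b * c\<^sup>2 = x\<^sup>2 * (2 * b + a)"
  obtains t where "x = c * t" "N * b = t\<^sup>2 * (2 * b + a)" "coprime a b" "b dvd t\<^sup>2" "t > 0"
proof -
  have cop: "coprime a b"
  proof (rule ccontr)
    assume "\<not> coprime a b"
    then obtain p where p: "prime p" "p dvd a" "p dvd b"
      using prime_factor_nat[of "gcd a b"] by (auto simp: coprime_iff_gcd_eq_1)
    then have "p dvd c\<^sup>2" unfolding law by (simp add: power2_eq_square)
    then have "p dvd c" using p(1) prime_dvd_power by blast
    with p have "p dvd Gcd {a, b, c}" by simp
    with gcd1 p(1) show False by simp
  qed
  have "coprime (c\<^sup>2) (2 * b + a)" using coprime_longest_side[OF law cop] by simp
  moreover have "c\<^sup>2 dvd x\<^sup>2 * (2 * b + a)" unfolding area[symmetric] by simp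
  ultimately have "c\<^sup>2 dvd x\<^sup>2" by (simp add: coprime_dvd_mult_left_iff)
  then have "c dvd x" by simp
  then obtain t where t: "x = c * t" by blast
  have "c\<^sup>2 * (N * b) = c\<^sup>2 * (t\<^sup>2 * (2 * b + a))"
    using area unfolding t by (simp add: power_mult_distrib mult_ac)
  then have N: "N * b = t\<^sup>2 * (2 * b + a)" using pos by simp
  have "coprime b (2 * b + a)" using cop
    by (metis coprime_commute coprime_iff_gcd_eq_1 gcd_add_mult mult.commute add.commute)
  moreover have "b dvd t\<^sup>2 * (2 * b + a)" unfolding N[symmetric] by simp
  ultimately have "b dvd t\<^sup>2" by (simp add: coprime_dvd_mult_left_iff)
  with t N cop show thesis using that pos by auto
qed

text \<open>Tuples $(N, a, b, c, t)$, where the leg is $ct$ and the base is $t(2b+a)$. Integers rather than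
  naturals keep the evaluation below in binary arithmetic.\<close>

definition small_solutions :: "(int \<times> int \<times> int \<times> int \<times> int) list" where
  "small_solutions = [(33, 5, 3, 7, 3), (37, 5, 16, 19, 4), (46, 7, 8, 13, 4), (65, 3, 5, 7, 5),
     (71, 39, 16, 49, 4), (74, 56, 9, 61, 3), (130, 16, 5, 19, 5), (132, 5, 3, 7, 6),
     (148, 5, 16, 19, 8), (154, 8, 7, 13, 7), (184, 7, 8, 13, 8), (193, 143, 25, 157, 5)]"


text \<open>The number $k$ stands for $c - a$. The conditionals, in place of implications, let the rewriting
  stop at the first test that fails.\<close>

lemma small_search:
  "list_all (\<lambda>t. list_all (\<lambda>b. if t * t mod b \<noteq> 0 then True else list_all (\<lambda>k.
      if 2 * k \<le> b then True else
      if (b * b - k * k) mod (2 * k - b) \<noteq> 0 then True else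
      (let a = (b * b - k * k) div (2 * k - b) in if gcd a b \<noteq> 1 then True else
         if t * t * (2 * b + a) > 200 * b then True else
         List.member small_solutions (t * t * (2 * b + a) div b, a, b, a + k, t)))
      [1..b - 1]) [1..81]) [1..9 :: int]"
  by code_simp


text \<open>The law of cosines becomes linear in $a$ once $c - a$ is given.\<close>

lemma excess_of_longest_side:
  fixes a b k :: int
  assumes pos: "a > 0" "b > 0" "k > 0" and law: "(a + k)\<^sup>2 = a\<^sup>2 + a * b + b\<^sup>2"
  shows "a * (2 * k - b) = b * b - k * k" "k < b" "b < 2 * k"
proof -
  show eq: "a * (2 * k - b) = b * b - k * k"
    using law by (simp add: power2_eq_square algebra_simps)
  show "b < 2 * k"
  proof (rule ccontr)
    assume "\<not> b < 2 * k"
    then have "a * (2 * k - b) \<le> 0" "k < b" using pos by (simp_all add: mult_le_0_iff)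
    moreover have "k * k < b * b" using \<open>k < b\<close> pos by (intro mult_strict_mono) auto
    ultimately show False using eq by linarith
  qed
  show "k < b"
  proof (rule ccontr)
    assume "\<not> k < b"
    then have "a * (2 * k - b) > 0" using pos by (intro mult_pos_pos) auto
    moreover have "b * b \<le> k * k" using \<open>\<not> k < b\<close> pos by (intro mult_mono) auto
    ultimately show False using eq by linarith
  qed
qed

text \<open>From $t^2(2b + a) = Nb \le 200b$ follows $t^2 < 100$, and $b$ divides $t^2$, so the search range
  of \<open>small_search\<close> is large enough.\<close>

lemma small_tilings:
  fixes N a b c x :: nat
  assumes pos: "a > 0" "b > 0" "c > 0" "x > 0"
    and law: "c\<^sup>2 = a\<^sup>2 + a * b + b\<^sup>2" and gcd1: "Gcd {a, b, c} = 1"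
    and area: "N * b * c\<^sup>2 = x\<^sup>2 * (2 * b + a)" and N: "N \<le> 200"
  shows "\<exists>t. x = c * t \<and> (int N, int a, int b, int c, int t) \<in> set small_solutions"
proof -
  obtain t where t: "x = c * t" "N * b = t\<^sup>2 * (2 * b + a)" "coprime a b" "b dvd t\<^sup>2" "t > 0"
    using tile_search_bounds[OF pos law gcd1 area] .
  have le: "t\<^sup>2 * (2 * b + a) \<le> 200 * b" unfolding t(2)[symmetric] using N by simp
  have "t\<^sup>2 * (2 * b) < t\<^sup>2 * (2 * b + a)" using pos t(5) by simp
  with le have "t\<^sup>2 * b < 100 * b" by linarith
  then have "t\<^sup>2 < 10\<^sup>2" by simp
  then have t9: "t \<le> 9" using power_less_imp_less_base[of t 2 10] by simp
  then have "t\<^sup>2 \<le> 9\<^sup>2" by (intro power_mono) auto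
  then have b81: "b \<le> 81" using dvd_imp_le[OF t(4)] t(5) by simp
  have "a\<^sup>2 < c\<^sup>2" unfolding law using pos by simp
  then have ac: "a < c" using power_less_imp_less_base[of a 2 c] by simp
  define k where "k = int c - int a"
  have c: "int c = int a + k" by (simp add: k_def)
  have "(int c)\<^sup>2 = (int a)\<^sup>2 + int a * int b + (int b)\<^sup>2"
    using law by (metis of_nat_add of_nat_mult of_nat_power)
  then have law': "(int a + k)\<^sup>2 = (int a)\<^sup>2 + int a * int b + (int b)\<^sup>2" by (simp only: c)
  have "k > 0" using ac by (simp add: k_def)
  note k = excess_of_longest_side[OF _ _ this law']
  have k': "int a * (2 * k - int b) = int b * int b - k * k" "k < int b" "int b < 2 * k"
    using k pos by simp_all
  have div: "(int b * int b - k * k) div (2 * k - int b) = int a"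
    "(int b * int b - k * k) mod (2 * k - int b) = 0"
    using k'(3) unfolding k'(1)[symmetric] by simp_all
  have tb: "int t * int t mod int b = 0"
    using t(4) by (metis dvd_imp_mod_0 int_dvd_int_iff of_nat_mult power2_eq_square)
  have g: "gcd (int a) (int b) = 1" using t(3) by (simp add: coprime_iff_gcd_eq_1)
  have le': "int t * int t * (2 * int b + int a) \<le> 200 * int b"
  proof -
    have "int (t\<^sup>2 * (2 * b + a)) \<le> int (200 * b)" using le by linarith
    then show ?thesis by (simp add: power2_eq_square)
  qed
  have "int N * int b = int t * int t * (2 * int b + int a)"
    using arg_cong[OF t(2), of int] by (simp add: power2_eq_square)
  then have Nd: "int t * int t * (2 * int b + int a) div int b = int N"
    using pos by (metis nonzero_mult_div_cancel_right of_nat_0_eq_iff less_irrefl)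
  have mem: "int t \<in> set [1..9]" "int b \<in> set [1..81]" "k \<in> set [1..int b - 1]"
    using t9 t(5) b81 pos \<open>k > 0\<close> k'(2) by auto
  have "List.member small_solutions (int N, int a, int b, int a + k, int t)"
    using bspec[OF small_search[unfolded list.pred_set, rule_format, OF mem(1,2), unfolded tb,
      simplified simp_thms if_False] mem(3)] k'(3) div g le' Nd
    by (simp add: Let_def)
  then show ?thesis using t(1) c by (auto simp: List.member_iff)
qed

section \<open>Congruent copies, angles and areas\<close>

lemma angle_at_inner:
  assumes "U \<noteq> V" "W \<noteq> V" and "angle_at V U W = t"
  shows "inner (U - V) (W - V) = dist V U * dist V W * cos t" "0 \<le> t" "t \<le> pi"
proof -
  let ?x = "inner (U - V) (W - V) / (norm (U - V) * norm (W - V))"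
  have n: "norm (U - V) * norm (W - V) > 0" using assms by simp
  have "\<bar>inner (U - V) (W - V)\<bar> \<le> norm (U - V) * norm (W - V)" by (rule Cauchy_Schwarz_ineq2)
  then have "\<bar>?x\<bar> \<le> 1" using n unfolding abs_divide by (simp add: abs_mult)
  then have x: "-1 \<le> ?x" "?x \<le> 1" by linarith+
  have t: "t = arccos ?x" using assms(3) by (simp add: angle_at_def)
  show "0 \<le> t" "t \<le> pi" unfolding t using x arccos_lbound arccos_ubound by blast+
  have "cos t = ?x" unfolding t using x by (rule cos_arccos)
  then show "inner (U - V) (W - V) = dist V U * dist V W * cos t"
    using n by (simp add: dist_norm norm_minus_commute)
qed

text \<open>If the cross product vanishes, the identity of Lagrange is the equality case of the Cauchy-Schwarz inequality.\<close>

lemma noncollinear_cross2: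
  assumes "\<not> collinear {P, Q, R}"
  shows "cross2 (Q - P) (R - P) \<noteq> 0"
proof
  assume "cross2 (Q - P) (R - P) = 0"
  then have "(inner (Q - P) (R - P))\<^sup>2 = (norm (Q - P) * norm (R - P))\<^sup>2"
    using lagrange_identity_2[of "Q - P" "R - P"] by (simp add: power_mult_distrib)
  then have "\<bar>inner (Q - P) (R - P)\<bar> = norm (Q - P) * norm (R - P)"
    using arg_cong[of _ _ sqrt] by (metis abs_mult abs_norm_cancel real_sqrt_abs)
  then have "collinear {0, Q - P, R - P}" by (simp add: norm_cauchy_schwarz_equal)
  then have "collinear {Q, P, R}" by (subst collinear_3) (simp_all add: NO_MATCH_def)
  with assms show False by (simp add: insert_commute)
qed

text \<open>An isometry of the plane is a translation after a linear map, and both commute with convex hulls.\<close>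

lemma isometry_image_triangle:
  fixes f :: "real^2 \<Rightarrow> real^2"
  assumes f: "\<And>x y. dist (f x) (f y) = dist x y"
  shows "f ` (convex hull {P, Q, R}) = convex hull {f P, f Q, f R}"
proof -
  define g where "g x = f x - f 0" for x
  have "orthogonal_transformation g"
    unfolding orthogonal_transformation_isometry using f by (simp add: g_def dist_norm)
  then have lin: "linear g" by (rule orthogonal_transformation_linear)
  have fg: "f x = f 0 + g x" for x by (simp add: g_def)
  have img: "f ` S = (+) (f 0) ` (g ` S)" for S unfolding image_image fg[symmetric] ..
  have "f ` (convex hull {P, Q, R}) = (+) (f 0) ` (convex hull (g ` {P, Q, R}))"
    unfolding img convex_hull_linear_image[OF lin] ..
  also have "\<dots> = convex hull (f ` {P, Q, R})"
    unfolding img[of "{P, Q, R}"] by (rule convex_hull_translation[symmetric])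
  finally show ?thesis by simp
qed

lemma cross2_abs_angle:
  assumes "inner u v = norm u * norm v * cos t" "sin t \<ge> 0"
  shows "\<bar>cross2 u v\<bar> = norm u * norm v * sin t"
proof -
  have "\<bar>cross2 u v\<bar>\<^sup>2 = (norm u)\<^sup>2 * (norm v)\<^sup>2 - (norm u * norm v * cos t)\<^sup>2"
    using lagrange_identity_2[of u v] assms by simp
  also have "\<dots> = (norm u * norm v * sin t)\<^sup>2"
    by (simp add: power_mult_distrib sin_squared_eq algebra_simps)
  finally show ?thesis by (rule power2_eq_imp_eq) (use assms in auto)
qed

lemma triangle_area_cross2:
  "measure lebesgue (convex hull {P, Q, R :: real^2}) = \<bar>cross2 (Q - P) (R - P)\<bar> / 2"
proof -
  have "compact (convex hull {P, Q, R})" by (intro finite_imp_compact_convex_hull) auto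
  then have "measure lebesgue (convex hull {P, Q, R}) = measure lborel (convex hull {P, Q, R})"
    by (intro measure_completion) (auto dest: compact_imp_closed)
  also have "\<dots> = \<bar>cross2 (Q - P) (R - P)\<bar> / 2"
    unfolding content_triangle cross2_def by (simp add: mult.commute abs_minus_commute)
  finally show ?thesis .
qed

text \<open>Two tiles overlap in boundary points only, and the boundary of a convex set is a null set.\<close>

lemma tiling_measure:
  assumes til: "is_tiling N \<T> S T" and T: "\<And>U. U \<in> \<T> \<Longrightarrow> convex U \<and> bounded U \<and> measure lebesgue U = v"
  shows "measure lebesgue S = N * v"
proof -
  from til have fin: "finite \<T>" and N: "card \<T> = N" and S: "\<Union>\<T> = S"
    and disj: "\<And>U V. U \<in> \<T> \<Longrightarrow> V \<in> \<T> \<Longrightarrow> U \<noteq> V \<Longrightarrow> interior U \<inter> interior V = {}"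
    unfolding is_tiling_def by auto
  have neg: "negligible (U \<inter> V)" if "U \<in> \<T>" "V \<in> \<T>" "U \<noteq> V" for U V
  proof (rule negligible_subset)
    show "negligible (frontier U \<union> frontier V)"
      using T that by (intro negligible_Un negligible_convex_frontier) auto
    show "U \<inter> V \<subseteq> frontier U \<union> frontier V"
      using disj[OF that] closure_subset unfolding frontier_def by blast
  qed
  have "measure lebesgue (\<Union>\<T>) = sum (measure lebesgue) \<T>"
    by (rule measure_negligible_finite_Union[OF fin])
      (use T neg in \<open>auto simp: pairwise_def intro: measurable_convex\<close>)
  then show ?thesis using T by (simp add: S N)
qed

text \<open>The law of cosines at $R$ gives the relation between the sides, the one at $P$ gives
  $\cos\alpha$; then $4c^2 - (2b+a)^2 = 3a^2$ gives $\sin\alpha$.\<close>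

lemma tile_shape_from_angles:
  assumes nc: "\<not> collinear {P, Q, R}"
    and \<alpha>: "angle_at P Q R = \<alpha>" and \<gamma>: "angle_at R P Q = 2 * pi / 3"
  shows "tile_shape (dist Q R) (dist P R) (dist P Q) \<alpha>"
proof -
  let ?a = "dist Q R" and ?b = "dist P R" and ?c = "dist P Q"
  have ne: "P \<noteq> Q" "Q \<noteq> R" "R \<noteq> P" using noncollinear_cross2[OF nc] by (auto simp: cross2_def)
  have pos: "?a > 0" "?b > 0" "?c > 0" using ne by auto
  have "inner (P - R) (Q - R) = ?b * ?a * cos (2 * pi / 3)"
    using angle_at_inner(1)[OF _ _ \<gamma>] ne by (simp add: dist_commute)
  then have "- (?b * ?a) = ?b\<^sup>2 + ?a\<^sup>2 - ?c\<^sup>2"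
    using inner_at_vertex[of P R Q] by (simp add: cos_120 dist_commute)
  then have law: "?c\<^sup>2 = ?a\<^sup>2 + ?a * ?b + ?b\<^sup>2" by (simp add: algebra_simps)
  have i: "inner (Q - P) (R - P) = ?c * ?b * cos \<alpha>" and \<alpha>_bounds: "0 \<le> \<alpha>" "\<alpha> \<le> pi"
    using angle_at_inner[OF _ _ \<alpha>] ne by simp_all
  have "2 * (?c * ?b * cos \<alpha>) = ?c\<^sup>2 + ?b\<^sup>2 - ?a\<^sup>2"
    using inner_at_vertex[of Q P R] i by simp
  also have "\<dots> = ?b * (2 * ?b + ?a)" unfolding law by (simp add: power2_eq_square algebra_simps)
  finally have "?b * (2 * ?c * cos \<alpha>) = ?b * (2 * ?b + ?a)" by (simp add: mult_ac)
  then have "2 * ?c * cos \<alpha> = 2 * ?b + ?a" using pos by simp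
  then have cos: "cos \<alpha> = (2 * ?b + ?a) / (2 * ?c)" using pos by (simp add: field_simps)
  have "(2 * ?c * sin \<alpha>)\<^sup>2 = (2 * ?c)\<^sup>2 - (2 * ?c * cos \<alpha>)\<^sup>2"
    by (simp add: power_mult_distrib sin_squared_eq algebra_simps)
  also have "\<dots> = 4 * ?c\<^sup>2 - (2 * ?b + ?a)\<^sup>2"
    using \<open>2 * ?c * cos \<alpha> = 2 * ?b + ?a\<close> by simp
  also have "\<dots> = (sqrt 3 * ?a)\<^sup>2"
    unfolding law by (simp add: power_mult_distrib power2_sum algebra_simps)
  finally have "2 * ?c * sin \<alpha> = sqrt 3 * ?a"
    using pos sin_ge_zero[OF \<alpha>_bounds] by (simp add: power2_eq_iff_nonneg)
  then have "sin \<alpha> = sqrt 3 * ?a / (2 * ?c)" using pos by (simp add: field_simps)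
  with pos law cos show ?thesis by unfold_locales auto
qed

text \<open>If the isometry reverses the orientation, the images of $P$ and $Q$ are exchanged to list the
  vertices counterclockwise.\<close>

lemma congruent_tile_vertices:
  assumes nc: "\<not> collinear {P, Q, R}" and cong: "congruent_sets (triangle_region P Q R) U"
  shows "\<exists>p q r. U = convex hull {p, q, r} \<and> ccw p q r \<and>
    (\<exists>P' Q'. {P', Q'} = {p, q} \<and> dist Q' r = dist Q R \<and> dist P' r = dist P R \<and> dist P' Q' = dist P Q)"
proof -
  obtain f :: "real^2 \<Rightarrow> real^2" where f: "\<And>x y. dist (f x) (f y) = dist x y"
    and U: "f ` (convex hull {P, Q, R}) = U"
    using cong unfolding congruent_sets_def triangle_region_def by blast
  let ?p = "f P" and ?q = "f Q" and ?r = "f R"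
  have U': "U = convex hull {?p, ?q, ?r}" using isometry_image_triangle[of f, OF f] U by simp
  have n: "norm (?q - ?p) = norm (Q - P)" "norm (?r - ?p) = norm (R - P)"
    using f by (simp_all flip: dist_norm)
  have i: "inner (?q - ?p) (?r - ?p) = inner (Q - P) (R - P)"
    using inner_at_vertex[of ?q ?p ?r] inner_at_vertex[of Q P R] by (simp add: f)
  have "(cross2 (?q - ?p) (?r - ?p))\<^sup>2 = (cross2 (Q - P) (R - P))\<^sup>2"
    using lagrange_identity_2[of "?q - ?p" "?r - ?p"] lagrange_identity_2[of "Q - P" "R - P"]
    unfolding i n by simp
  then have "cross2 (?q - ?p) (?r - ?p) \<noteq> 0" using noncollinear_cross2[OF nc] by auto
  then consider "ccw ?p ?q ?r" | "cross2 (?q - ?p) (?r - ?p) < 0" by linarith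
  then show ?thesis
  proof cases
    case 1
    then show ?thesis using U' f by blast
  next
    case 2
    then have "ccw ?q ?p ?r" by (simp add: cross2_def algebra_simps)
    moreover have "U = convex hull {?q, ?p, ?r}" using U' by (simp add: insert_commute)
    moreover have "{?p, ?q} = {?q, ?p}" by blast
    ultimately show ?thesis using f by blast
  qed
qed

lemma tiling_relations:
  assumes irr: "\<alpha> / pi \<notin> \<rat>" and nc: "\<not> collinear {P, Q, R}"
    and shape: "tile_shape (dist Q R) (dist P R) (dist P Q) \<alpha>"
    and big: "ccw A C B" and legs: "dist A B = X" "dist B C = X" and base: "dist A C = Y"
    and Y: "Y = 2 * X * cos \<alpha>"
    and til: "is_tiling N \<T> (triangle_region A B C) (triangle_region P Q R)"
  shows "\<exists>M :: int. Y - 2 * X = M * (dist P Q + (dist Q R - dist P R))"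
    and "\<exists>M :: int. Y + 2 * X = M * (dist P Q - (dist Q R - dist P R))"
    and "\<exists>(k :: int) (l :: int) (m :: int). X = k * dist Q R + l * dist P R + m * dist P Q"
proof -
  from til have fin: "finite \<T>" and S: "\<Union>\<T> = convex hull {A, B, C}"
    and cong: "\<And>U. U \<in> \<T> \<Longrightarrow> congruent_sets (triangle_region P Q R) U"
    and disj: "\<And>U V. U \<in> \<T> \<Longrightarrow> V \<in> \<T> \<Longrightarrow> U \<noteq> V \<Longrightarrow> interior U \<inter> interior V = {}"
    unfolding is_tiling_def triangle_region_def by auto
  from cong congruent_tile_vertices[OF nc] obtain p q r where
    U: "\<And>U. U \<in> \<T> \<Longrightarrow> U = convex hull {p U, q U, r U}"
    and t: "\<And>U. U \<in> \<T> \<Longrightarrow> ccw (p U) (q U) (r U)"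
    and d: "\<And>U. U \<in> \<T> \<Longrightarrow> \<exists>P' Q'. {P', Q'} = {p U, q U} \<and> dist Q' (r U) = dist Q R \<and>
      dist P' (r U) = dist P R \<and> dist P' Q' = dist P Q" by metis
  have disj': "interior (convex hull {p U, q U, r U}) \<inter> interior (convex hull {p V, q V, r V}) = {}"
    if "U \<in> \<T>" "V \<in> \<T>" "U \<noteq> V" for U V
    using disj[OF that] unfolding U[OF that(1), symmetric] U[OF that(2), symmetric] .
  have "(\<Union>U\<in>\<T>. convex hull {p U, q U, r U}) = \<Union>\<T>" using U by auto
  then have cover: "(\<Union>U\<in>\<T>. convex hull {p U, q U, r U}) = convex hull {A, C, B}"
    unfolding S by (simp add: insert_commute)
  have tri: "triangle_tiling \<T> p q r A C B"
    by (rule triangle_tiling.intro[OF fin t big disj' cover])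
  have ax: "isosceles_tiling_axioms \<T> p q r A B C (dist Q R) (dist P R) (dist P Q) \<alpha> X Y"
    by (rule isosceles_tiling_axioms.intro[OF d legs base Y irr])
  interpret isosceles_tiling \<T> p q r A B C "dist Q R" "dist P R" "dist P Q" \<alpha> X Y
    by (rule isosceles_tiling.intro[OF tri shape ax])
  show "\<exists>M :: int. Y - 2 * X = M * (dist P Q + (dist Q R - dist P R))"
    using signed_boundary_relation[of 0] by simp
  show "\<exists>M :: int. Y + 2 * X = M * (dist P Q - (dist Q R - dist P R))"
    using signed_boundary_relation[of 1] by (simp add: algebra_simps)
  show "\<exists>(k :: int) (l :: int) (m :: int). X = k * dist Q R + l * dist P R + m * dist P Q"
    by (rule leg_integer_combination)
qed

text \<open>Both kinds of triangle have the angle $\alpha$, so $\sin\alpha$ cancels from the comparison of areas.\<close>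

lemma tiling_area_relation:
  assumes nc: "\<not> collinear {P, Q, R}"
    and \<alpha>: "angle_at P Q R = \<alpha>" "angle_at A B C = \<alpha>"
    and shape: "tile_shape (dist Q R) (dist P R) (dist P Q) \<alpha>"
    and big: "\<not> collinear {A, B, C}"
    and til: "is_tiling N \<T> (triangle_region A B C) (triangle_region P Q R)"
  shows "N * (dist P Q * dist P R) = dist A B * dist A C"
proof -
  interpret tile_shape "dist Q R" "dist P R" "dist P Q" \<alpha> by (rule shape)
  have s: "sin \<alpha> > 0" using pos by (simp add: sin_\<alpha>)
  have area: "measure lebesgue (convex hull {U, V, W}) = dist U V * dist U W * sin \<alpha> / 2"
    if i: "inner (V - U) (W - U) = dist U V * dist U W * cos \<alpha>" for U V W :: "real^2"
    using cross2_abs_angle[of "V - U" "W - U" \<alpha>] s i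
    by (simp add: triangle_area_cross2 dist_norm norm_minus_commute)
  have ne: "P \<noteq> Q" "R \<noteq> P" using noncollinear_cross2[OF nc] by (auto simp: cross2_def)
  have ne': "A \<noteq> B" "C \<noteq> A" using noncollinear_cross2[OF big] by (auto simp: cross2_def)
  have PQR: "inner (Q - P) (R - P) = dist P Q * dist P R * cos \<alpha>"
    using angle_at_inner(1)[OF _ _ \<alpha>(1)] ne by simp
  have "convex U \<and> bounded U \<and> measure lebesgue U = dist P Q * dist P R * sin \<alpha> / 2" if "U \<in> \<T>" for U
  proof -
    have "congruent_sets (triangle_region P Q R) U"
      using til \<open>U \<in> \<T>\<close> unfolding is_tiling_def by blast
    then obtain f :: "real^2 \<Rightarrow> real^2" where f: "\<And>x y. dist (f x) (f y) = dist x y"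
      and "f ` (convex hull {P, Q, R}) = U"
      unfolding congruent_sets_def triangle_region_def by blast
    then have U: "U = convex hull {f P, f Q, f R}" using isometry_image_triangle[of f, OF f] by simp
    have "inner (f Q - f P) (f R - f P) = inner (Q - P) (R - P)"
      using inner_at_vertex[of "f Q" "f P" "f R"] inner_at_vertex[of Q P R] by (simp add: f)
    then have "measure lebesgue U = dist P Q * dist P R * sin \<alpha> / 2"
      unfolding U by (subst area) (simp_all add: f PQR)
    then show ?thesis unfolding U by (simp add: convex_convex_hull bounded_convex_hull)
  qed
  from tiling_measure[OF til this] have "measure lebesgue (convex hull {A, B, C})
     = N * (dist P Q * dist P R * sin \<alpha> / 2)" by (simp add: triangle_region_def)
  moreover have "measure lebesgue (convex hull {A, B, C}) = dist A B * dist A C * sin \<alpha> / 2"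
    using angle_at_inner(1)[OF _ _ \<alpha>(2)] ne' by (intro area) simp
  ultimately show ?thesis using s by (simp add: field_simps)
qed

section \<open>The table of small tilings\<close>

theorem theorem12p10:
  fixes A B C P Q R :: "real^2" and \<alpha> \<beta> :: real
    and N :: nat and \<T> :: "(real^2) set set"
  assumes "\<alpha> / pi \<notin> \<rat>"
    and "isosceles_triangle A B C"
    and "angle_at A B C = \<alpha>" and "angle_at C A B = \<alpha>"
    and "\<not> collinear {P, Q, R}"
    and "angle_at P Q R = \<alpha>" and "angle_at Q P R = \<beta>" and "angle_at R P Q = 2 * pi / 3"
    and "is_tiling N \<T> (triangle_region A B C) (triangle_region P Q R)"
  shows "33 \<le> N \<and>
    (N \<le> 200 \<longrightarrow>
      (\<exists>s a b c. coprime_integer_scaling P Q R s a b c) \<and>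
      (\<forall>s a b c. coprime_integer_scaling P Q R s a b c \<longrightarrow>
         (N, (a, b, c), (s * dist A B, s * dist A C)) \<in> tiling_table))"
proof -
  define a b c where "a = dist Q R" and "b = dist P R" and "c = dist P Q"
  define X Y where "X = dist A B" and "Y = dist A C"
  have shape: "tile_shape (dist Q R) (dist P R) (dist P Q) \<alpha>"
    by (rule tile_shape_from_angles) fact+
  interpret tile_shape a b c \<alpha> using shape by (simp add: a_def b_def c_def)
  have big: "\<not> collinear {A, B, C}" and BC: "dist B C = X"
    using assms(2) by (simp_all add: isosceles_triangle_def X_def)
  have cr: "cross2 (B - A) (C - A) \<noteq> 0" using noncollinear_cross2[OF big] .
  then have ne: "A \<noteq> B" "C \<noteq> A" by (auto simp: cross2_def)
  have XY: "X > 0" "Y > 0" using ne by (auto simp: X_def Y_def)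
  have "2 * (X * Y * cos \<alpha>) = Y\<^sup>2"
    using angle_at_inner(1)[OF _ _ assms(3)] inner_at_vertex[of B A C] ne BC by (simp add: X_def Y_def)
  then have Y: "Y = 2 * X * cos \<alpha>" using XY by (simp add: power2_eq_square mult_ac)
  then have base: "Y * c = X * (2 * b + a)" using pos by (simp add: cos_\<alpha> field_simps)
  have "N * (c * b) = X * Y"
    using tiling_area_relation[OF assms(5,6,3) shape big assms(9)]
    by (simp add: b_def c_def X_def Y_def)
  then have "N * b * c\<^sup>2 = X * (Y * c)" by (simp add: power2_eq_square mult_ac)
  then have area: "N * b * c\<^sup>2 = X\<^sup>2 * (2 * b + a)" unfolding base by (simp add: power2_eq_square mult_ac)
  \<comment> \<open>The relations are symmetric in A and C, so the big triangle may be listed counterclockwise.\<close>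
  have rel: "(\<exists>M :: int. Y - 2 * X = M * (c + (a - b))) \<and> (\<exists>M :: int. Y + 2 * X = M * (c - (a - b)))
     \<and> (\<exists>(k :: int) (l :: int) (m :: int). X = k * a + l * b + m * c)"
  proof (cases "ccw A C B")
    case True
    show ?thesis
      using tiling_relations[OF assms(1,5) shape True X_def[symmetric] BC Y_def[symmetric] Y assms(9)]
      unfolding a_def b_def c_def by blast
  next
    case False
    then have t: "ccw C A B" using cr by (simp add: cross2_def algebra_simps)
    have til: "is_tiling N \<T> (triangle_region C B A) (triangle_region P Q R)"
      using assms(9) by (simp add: triangle_region_def insert_commute)
    have d: "dist C B = X" "dist B A = X" "dist C A = Y"
      using BC by (simp_all add: X_def Y_def dist_commute)
    show ?thesis using tiling_relations[OF assms(1,5) shape t d Y til]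
      unfolding a_def b_def c_def by blast
  qed
  then obtain M\<^sub>1 M\<^sub>2 i j l :: int where M: "Y - 2 * X = M\<^sub>1 * (c + (a - b))" "Y + 2 * X = M\<^sub>2 * (c - (a - b))"
    and comb: "X = i * a + j * b + l * c" by blast
  have "b / a \<in> \<rat> \<and> c / a \<in> \<rat>"
    by (rule commensurable_sides[OF pos XY(1) law M base area])
  then have ex: "\<exists>s k l m. coprime_integer_scaling P Q R s k l m"
    using coprime_integer_multiple[OF pos] unfolding coprime_integer_scaling_def a_def b_def c_def by blast
  have all: "(N, (k, m, n), (s * dist A B, s * dist A C)) \<in> tiling_table"
    if sc: "coprime_integer_scaling P Q R s k m n" and N: "N \<le> 200" for s k m n
  proof -
    from sc have s: "s > 0" "Gcd {k, m, n} = 1" "s * a = real k" "s * b = real m" "s * c = real n"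
      by (simp_all add: coprime_integer_scaling_def a_def b_def c_def)
    have npos: "k > 0" "m > 0" "n > 0" using s pos
      by (metis mult_pos_pos of_nat_0_less_iff)+
    have "(s * c)\<^sup>2 = (s * a)\<^sup>2 + (s * a) * (s * b) + (s * b)\<^sup>2"
      using arg_cong[OF law, of "\<lambda>x. s\<^sup>2 * x"] by (simp add: power2_eq_square algebra_simps)
    then have "real (n\<^sup>2) = real (k\<^sup>2 + k * m + m\<^sup>2)" unfolding s by simp
    then have nlaw: "n\<^sup>2 = k\<^sup>2 + k * m + m\<^sup>2" by (simp only: of_nat_eq_iff)
    have "s * X = i * (s * a) + j * (s * b) + l * (s * c)"
      unfolding comb by (simp add: algebra_simps)
    then have "s * X = of_int (i * int k + j * int m + l * int n)" unfolding s by simp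
    moreover have sX: "s * X > 0" using s(1) XY by simp
    ultimately obtain x :: nat where x: "s * X = real x" "x > 0"
      by (metis of_int_0_less_iff of_int_of_nat_eq of_nat_0_less_iff pos_int_cases)
    have "real N * (s * b) * (s * c)\<^sup>2 = (s * X)\<^sup>2 * (2 * (s * b) + s * a)"
      using arg_cong[OF area, of "\<lambda>x. s ^ 3 * x"]
      by (simp add: power2_eq_square power3_eq_cube algebra_simps)
    then have "real (N * m * n\<^sup>2) = real (x\<^sup>2 * (2 * m + k))" unfolding s x by simp
    then have narea: "N * m * n\<^sup>2 = x\<^sup>2 * (2 * m + k)" by (simp only: of_nat_eq_iff)
    obtain t where t: "x = n * t" "(int N, int k, int m, int n, int t) \<in> set small_solutions"
      using small_tilings[OF npos x(2) nlaw s(2) narea N] by blast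
    have "(s * Y) * (s * c) = (s * X) * (2 * (s * b) + s * a)"
      using arg_cong[OF base, of "\<lambda>x. s\<^sup>2 * x"] by (simp add: power2_eq_square algebra_simps)
    then have "real n * (s * Y) = real n * real (t * (2 * m + k))" unfolding s x t by (simp add: algebra_simps)
    then have sY: "s * Y = real (t * (2 * m + k))" using npos by simp
    have "(N, (k, m, n), (real (n * t), real (t * (2 * m + k)))) \<in> tiling_table"
      using t(2) by (simp add: small_solutions_def, elim disjE; simp add: tiling_table_def)
    then show ?thesis using x(1) sY t(1) by (simp add: X_def Y_def)
  qed
  have "33 \<le> N"
  proof (rule ccontr)
    assume small: "\<not> 33 \<le> N"
    obtain s k m n where "coprime_integer_scaling P Q R s k m n" using ex by blast
    from all[OF this] small show False by (simp add: tiling_table_def)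
  qed
  with ex all show ?thesis by blast
qed

end
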